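(* Let $k$ be a field of characteristic $0$, let $(\mathfrak g,B)$ be a finite-dimensional quadratic Lie algebra over $k$ with a $\mathbb Z_2$-gradation $\mathfrak g=\mathfrak k\oplus\mathfrak p$ such that $\mathfrak k$ and $\mathfrak p$ are $B$-orthogonal. In the algebra $U(\mathfrak g)\otimes \mathcal W(\mathfrak p\oplus\mathfrak p^*,\omega)$ one has $$[D^+,D^-]=\big(-\Omega(\mathfrak g)+\Omega(\mathfrak k)\big)\otimes 1-\sum_k w_k\otimes\nu(w^k)=\Big(-\Omega(\mathfrak g)+\tfrac32\Omega(\mathfrak k)\Big)\otimes 1-\tfrac12\Delta(\Omega(\mathfrak k))+\tfrac12\cdot 1\otimes\nu(\Omega(\mathfrak k)).$$
   Context: A quadratic Lie algebra $(\mathfrak g,B)$ is a Lie algebra with a nondegenerate invariant symmetric bilinear form $B$. $\mathbb Z_2$-gradation: $[\mathfrak k,\mathfrak k]\subset\mathfrak k$, $[\mathfrak k,\mathfrak p]\subset\mathfrak p$, $[\mathfrak p,\mathfrak p]\subset\mathfrak k$. Let $\{w_k\}$ be a basis of $\mathfrak k$ with $B$-dual basis $\{w^k\}$ of $\mathfrak k$; $\{z_i\}$ a basis of $\mathfrak p$ with $B$-dual basis $\{z^i\}$ of $\mathfrak p$, and $\{z_i^*\}\subset\mathfrak p^*$ the dual basis of $\{z_i\}$. Casimir elements: $\Omega(\mathfrak k)=\sum_k w_kw^k\in U(\mathfrak k)\subset U(\mathfrak g)$ and $\Omega(\mathfrak g)=\Omega(\mathfrak k)+\sum_i z^iz_i\in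 U(\mathfrak g)$. $\omega$ is the symplectic form on $\mathfrak p\oplus\mathfrak p^*$ with $\omega(\mathfrak p,\mathfrak p)=\omega(\mathfrak p^*,\mathfrak p^* )=0$ and $\omega(\alpha,v)=\alpha(v)$ for $\alpha\in\mathfrak p^*$, $v\in\mathfrak p$. The Weyl algebra $\mathcal W(\mathfrak p\oplus\mathfrak p^*,\omega)$ is the quotient of the tensor algebra $T(\mathfrak p\oplus\mathfrak p^* )$ by the two-sided ideal generated by $v\otimes w-w\otimes v-\omega(v,w)1$; so $[z_i^*,z_j]=\delta_{ij}$. The symplectic Dirac elements (independent of the chosen basis) are $D^-=\sum_i z_i\otimes z_i^*$ and $D^+=\sum_i z_i\otimes z^i$ in $U(\mathfrak g)\otimes\mathcal W(\mathfrak p\oplus\mathfrak p^*,\omega)$. $\nu:\mathfrak k\to\mathcal W(\mathfrak p\oplus\mathfrak p^*,\omega)$ is the Lie algebra morphism $\nu(x)=\sum_i[x,z_i]z_i^*$, and $\Delta:\mathfrak k\to U(\mathfrak k)\otimes\mathcal W(\mathfrak p\oplus\mathfrak p^*,\omega)$ is the Lie algebra morphism $\Delta(x)=x\otimes1+1\otimes\nu(x)$; both are extended to algebra morphisms on $U(\mathfrak k)$. *)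

theory Defs
  imports
    Complex_Main
    "HOL-Library.Poly_Mapping"
    "HOL-Library.Function_Algebras"
    "HOL-Library.Product_Plus"
    "HOL-Algebra.QuotRing"
    "HOL-Algebra.Module"
begin

section \<open>Quadratic Lie algebras\<close>

locale lie_algebra = vector_space scale
  for scale :: "'k::field \<Rightarrow> 'g::ab_group_add \<Rightarrow> 'g" +
  fixes bracket :: "'g \<Rightarrow> 'g \<Rightarrow> 'g"
  assumes bracket_linear_left: "Vector_Spaces.linear scale scale (\<lambda>x. bracket x y)"
    and bracket_linear_right: "Vector_Spaces.linear scale scale (\<lambda>y. bracket x y)"
    and bracket_self: "bracket x x = 0"
    and jacobi: "bracket x (bracket y z) + bracket y (bracket z x) + bracket z (bracket x y) = 0"

locale quadratic_lie_algebra = lie_algebra scale bracket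
  for scale :: "'k::field \<Rightarrow> 'g::ab_group_add \<Rightarrow> 'g" and bracket +
  fixes B :: "'g \<Rightarrow> 'g \<Rightarrow> 'k"
  assumes B_linear: "Vector_Spaces.linear scale (*) (\<lambda>x. B x y)"
    and B_sym: "B x y = B y x"
    and B_nondegenerate: "(\<And>y. B x y = 0) \<Longrightarrow> x = 0"
    and B_invariant: "B (bracket x y) z = B x (bracket y z)"

locale z2_graded_quadratic_lie_algebra = quadratic_lie_algebra scale bracket B
  for scale :: "'k::field \<Rightarrow> 'g::ab_group_add \<Rightarrow> 'g" and bracket and B +
  fixes kk pp :: "'g set"
  assumes finite_dim: "\<exists>S. finite S \<and> span S = UNIV"
    and subspace_kk: "subspace kk"
    and subspace_pp: "subspace pp"
    and kk_int_pp: "kk \<inter> pp = {0}"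
    and kk_plus_pp: "\<exists>a\<in>kk. \<exists>b\<in>pp. x = a + b"
    and bracket_kk_kk: "\<lbrakk>x \<in> kk; y \<in> kk\<rbrakk> \<Longrightarrow> bracket x y \<in> kk"
    and bracket_kk_pp: "\<lbrakk>x \<in> kk; y \<in> pp\<rbrakk> \<Longrightarrow> bracket x y \<in> pp"
    and bracket_pp_pp: "\<lbrakk>x \<in> pp; y \<in> pp\<rbrakk> \<Longrightarrow> bracket x y \<in> kk"
    and kk_orth_pp: "\<lbrakk>x \<in> kk; y \<in> pp\<rbrakk> \<Longrightarrow> B x y = 0"

definition is_basis ::
  "('k::field \<Rightarrow> 'g::ab_group_add \<Rightarrow> 'g) \<Rightarrow> 'g set \<Rightarrow> 'i set \<Rightarrow> ('i \<Rightarrow> 'g) \<Rightarrow> bool" where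
  "is_basis scale S I e \<longleftrightarrow>
     finite I \<and> inj_on e I \<and> \<not> module.dependent scale (e ` I) \<and> module.span scale (e ` I) = S"

definition dual_family ::
  "('g \<Rightarrow> 'g \<Rightarrow> 'k::field) \<Rightarrow> 'g set \<Rightarrow> 'i set \<Rightarrow> ('i \<Rightarrow> 'g) \<Rightarrow> ('i \<Rightarrow> 'g) \<Rightarrow> bool" where
  "dual_family B S I e e' \<longleftrightarrow>
     (\<forall>i\<in>I. e' i \<in> S) \<and> (\<forall>i\<in>I. \<forall>j\<in>I. B (e i) (e' j) = (if i = j then 1 else 0))"

text \<open>Functionals on \<open>S\<close> are extended by \<open>0\<close> outside \<open>S\<close>, so that they are determined by
  their values on \<open>S\<close>.\<close>

definition dual_space ::
  "('k::field \<Rightarrow> 'g::ab_group_add \<Rightarrow> 'g) \<Rightarrow> 'g set \<Rightarrow> ('g \<Rightarrow> 'k) set" where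
  "dual_space scale S = {\<alpha>.
     (\<forall>x\<in>S. \<forall>y\<in>S. \<alpha> (x + y) = \<alpha> x + \<alpha> y) \<and>
     (\<forall>c. \<forall>x\<in>S. \<alpha> (scale c x) = c * \<alpha> x) \<and>
     (\<forall>x. x \<notin> S \<longrightarrow> \<alpha> x = 0)}"

definition dual_basis ::
  "('k::field \<Rightarrow> 'g::ab_group_add \<Rightarrow> 'g) \<Rightarrow> 'g set \<Rightarrow> 'i set \<Rightarrow> ('i \<Rightarrow> 'g) \<Rightarrow> ('i \<Rightarrow> 'g \<Rightarrow> 'k) \<Rightarrow> bool" where
  "dual_basis scale S I e es \<longleftrightarrow>
     (\<forall>i\<in>I. es i \<in> dual_space scale S) \<and>
     (\<forall>i\<in>I. \<forall>j\<in>I. es i (e j) = (if i = j then 1 else 0))"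


section \<open>Associative algebras over a field\<close>

text \<open>An associative unital algebra over \<^typ>\<open>'k\<close> is represented by a
  \<^typ>\<open>('k, 'a) module\<close> record: a ring with a scalar multiplication.\<close>

definition monoid_algebra :: "('m, 'e) monoid_scheme \<Rightarrow> ('k::field, 'm \<Rightarrow>\<^sub>0 'k) module" where
  "monoid_algebra M =
     \<lparr>carrier = {f. Poly_Mapping.keys f \<subseteq> carrier M},
      mult = (\<lambda>f g. \<Sum>a\<in>Poly_Mapping.keys f. \<Sum>b\<in>Poly_Mapping.keys g.
        Poly_Mapping.single (a \<otimes>\<^bsub>M\<^esub> b) (Poly_Mapping.lookup f a * Poly_Mapping.lookup g b)),
      one = Poly_Mapping.single \<one>\<^bsub>M\<^esub> 1,
      zero = 0,
      add = (+),
      smult = (\<lambda>c. Poly_Mapping.map ((*) c))\<rparr>"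

definition quot_algebra :: "('k, 'a) module \<Rightarrow> 'a set \<Rightarrow> ('k, 'a set) module" where
  "quot_algebra A I =
     ring.extend (A Quot I)
       (module.fields (\<lambda>c X. \<Union>x\<in>X. I +>\<^bsub>A\<^esub> (c \<odot>\<^bsub>A\<^esub> x)))"

text \<open>Linear extension to a monoid algebra of a map defined on the monoid, and the map induced on
  a quotient by a map that is constant on cosets.\<close>

definition lin_ext :: "('k::field, 'a) module \<Rightarrow> ('m \<Rightarrow> 'a) \<Rightarrow> ('m \<Rightarrow>\<^sub>0 'k) \<Rightarrow> 'a" where
  "lin_ext A f p = (\<Oplus>\<^bsub>A\<^esub>m\<in>Poly_Mapping.keys p. Poly_Mapping.lookup p m \<odot>\<^bsub>A\<^esub> f m)"

definition quot_lift :: "('a \<Rightarrow> 'b) \<Rightarrow> 'a set \<Rightarrow> 'b" where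
  "quot_lift h X = the_elem (h ` X)"

definition commutator :: "('a, 'e) ring_scheme \<Rightarrow> 'a \<Rightarrow> 'a \<Rightarrow> 'a" where
  "commutator R x y = (x \<otimes>\<^bsub>R\<^esub> y) \<ominus>\<^bsub>R\<^esub> (y \<otimes>\<^bsub>R\<^esub> x)"


subsection \<open>Tensor product of algebras\<close>

text \<open>\<open>A \<otimes> B\<close> is the vector space on \<open>A \<times> B\<close> modulo the bilinearity relations, with
  \<open>(a \<otimes> b)(c \<otimes> d) = ac \<otimes> bd\<close>. The span of the relations is stable under
  multiplication by pairs on both sides, so it coincides with the two-sided ideal used here.\<close>

definition alg_tensor_ideal ::
  "('k::field, 'a) module \<Rightarrow> ('k, 'b) module \<Rightarrow> ('a \<times> 'b \<Rightarrow>\<^sub>0 'k) set" where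
  "alg_tensor_ideal A B =
     genideal (monoid_algebra (A \<times>\<times> B) :: ('k, _) module)
      ({Poly_Mapping.single (a \<oplus>\<^bsub>A\<^esub> a', b) 1 - Poly_Mapping.single (a, b) 1
          - Poly_Mapping.single (a', b) 1
          | a a' b. a \<in> carrier A \<and> a' \<in> carrier A \<and> b \<in> carrier B} \<union>
       {Poly_Mapping.single (a, b \<oplus>\<^bsub>B\<^esub> b') 1 - Poly_Mapping.single (a, b) 1
          - Poly_Mapping.single (a, b') 1
          | a b b'. a \<in> carrier A \<and> b \<in> carrier B \<and> b' \<in> carrier B} \<union>
       {Poly_Mapping.single (c \<odot>\<^bsub>A\<^esub> a, b) 1 - Poly_Mapping.single (a, b) c
          | c a b. a \<in> carrier A \<and> b \<in> carrier B} \<union>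
       {Poly_Mapping.single (a, c \<odot>\<^bsub>B\<^esub> b) 1 - Poly_Mapping.single (a, b) c
          | c a b. a \<in> carrier A \<and> b \<in> carrier B})"

definition alg_tensor ::
  "('k::field, 'a) module \<Rightarrow> ('k, 'b) module \<Rightarrow> ('k, ('a \<times> 'b \<Rightarrow>\<^sub>0 'k) set) module" where
  "alg_tensor A B = quot_algebra (monoid_algebra (A \<times>\<times> B)) (alg_tensor_ideal A B)"

definition pure_tensor ::
  "('k::field, 'a) module \<Rightarrow> ('k, 'b) module \<Rightarrow> 'a \<Rightarrow> 'b \<Rightarrow> ('a \<times> 'b \<Rightarrow>\<^sub>0 'k) set" where
  "pure_tensor A B a b =
     alg_tensor_ideal A B +>\<^bsub>monoid_algebra (A \<times>\<times> B) :: ('k, _) module\<^esub> Poly_Mapping.single (a, b) 1"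

text \<open>The map \<open>f \<otimes> g\<close> into \<open>A' \<otimes> B'\<close>, for homomorphisms \<open>f\<close> into \<open>A'\<close> and \<open>g\<close> into
  \<open>B'\<close>.\<close>

definition alg_tensor_map ::
  "('k::field, 'c) module \<Rightarrow> ('k, 'd) module \<Rightarrow> ('a \<Rightarrow> 'c) \<Rightarrow> ('b \<Rightarrow> 'd) \<Rightarrow>
   ('a \<times> 'b \<Rightarrow>\<^sub>0 'k) set \<Rightarrow> ('c \<times> 'd \<Rightarrow>\<^sub>0 'k) set" where
  "alg_tensor_map A' B' f g =
     quot_lift (lin_ext (alg_tensor A' B') (\<lambda>(a, b). pure_tensor A' B' (f a) (g b)))"


subsection \<open>Tensor algebra of a vector space\<close>

text \<open>The vector space is the subset \<open>V\<close> of a type. Its tensor algebra is the free associative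
  algebra on the set \<open>V\<close> modulo the linear relations of \<open>V\<close>.\<close>

definition word_monoid :: "'v set \<Rightarrow> 'v list monoid" where
  "word_monoid V = \<lparr>carrier = lists V, mult = (@), one = []\<rparr>"

definition tensor_ideal ::
  "('k::field \<Rightarrow> 'v::ab_group_add \<Rightarrow> 'v) \<Rightarrow> 'v set \<Rightarrow> ('v list \<Rightarrow>\<^sub>0 'k) set" where
  "tensor_ideal scale V =
     genideal (monoid_algebra (word_monoid V) :: ('k, _) module)
      ({Poly_Mapping.single [x + y] 1 - Poly_Mapping.single [x] 1 - Poly_Mapping.single [y] 1
          | x y. x \<in> V \<and> y \<in> V} \<union>
       {Poly_Mapping.single [scale c x] 1 - Poly_Mapping.single [x] c | c x. x \<in> V})"

definition tensor_algebra ::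
  "('k::field \<Rightarrow> 'v::ab_group_add \<Rightarrow> 'v) \<Rightarrow> 'v set \<Rightarrow> ('k, ('v list \<Rightarrow>\<^sub>0 'k) set) module" where
  "tensor_algebra scale V = quot_algebra (monoid_algebra (word_monoid V)) (tensor_ideal scale V)"

definition tensor_gen ::
  "('k::field \<Rightarrow> 'v::ab_group_add \<Rightarrow> 'v) \<Rightarrow> 'v set \<Rightarrow> 'v \<Rightarrow> ('v list \<Rightarrow>\<^sub>0 'k) set" where
  "tensor_gen scale V x =
     tensor_ideal scale V +>\<^bsub>monoid_algebra (word_monoid V) :: ('k, _) module\<^esub> Poly_Mapping.single [x] 1"


subsection \<open>Universal enveloping algebra\<close>

text \<open>\<open>L\<close> is a Lie subalgebra of the ambient Lie algebra, and \<open>env_gen scale bracket L\<close> is the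
  canonical map from \<open>L\<close> to \<open>U(L)\<close>.\<close>

definition env_ideal ::
  "('k::field \<Rightarrow> 'g::ab_group_add \<Rightarrow> 'g) \<Rightarrow> ('g \<Rightarrow> 'g \<Rightarrow> 'g) \<Rightarrow> 'g set \<Rightarrow>
   ('g list \<Rightarrow>\<^sub>0 'k) set set" where
  "env_ideal scale bracket L =
     genideal (tensor_algebra scale L)
       {commutator (tensor_algebra scale L) (tensor_gen scale L x) (tensor_gen scale L y)
          \<ominus>\<^bsub>tensor_algebra scale L\<^esub> tensor_gen scale L (bracket x y) | x y. x \<in> L \<and> y \<in> L}"

definition env_algebra ::
  "('k::field \<Rightarrow> 'g::ab_group_add \<Rightarrow> 'g) \<Rightarrow> ('g \<Rightarrow> 'g \<Rightarrow> 'g) \<Rightarrow> 'g set \<Rightarrow>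
   ('k, ('g list \<Rightarrow>\<^sub>0 'k) set set) module" where
  "env_algebra scale bracket L = quot_algebra (tensor_algebra scale L) (env_ideal scale bracket L)"

definition env_gen ::
  "('k::field \<Rightarrow> 'g::ab_group_add \<Rightarrow> 'g) \<Rightarrow> ('g \<Rightarrow> 'g \<Rightarrow> 'g) \<Rightarrow> 'g set \<Rightarrow> 'g \<Rightarrow>
   ('g list \<Rightarrow>\<^sub>0 'k) set set" where
  "env_gen scale bracket L x =
     env_ideal scale bracket L +>\<^bsub>tensor_algebra scale L\<^esub> tensor_gen scale L x"

text \<open>The algebra morphism \<open>U(L) \<rightarrow> A\<close> that extends a Lie algebra morphism \<open>f\<close> from \<open>L\<close> to
  \<open>A\<close>: a word \<open>[x1, ..., xn]\<close> goes to \<open>f x1 \<cdots> f xn\<close>, and the resulting map on the free algebra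
  descends first to the tensor algebra and then to \<open>U(L)\<close>.\<close>

definition env_lift ::
  "('k::field, 'a) module \<Rightarrow> ('g \<Rightarrow> 'a) \<Rightarrow> ('g list \<Rightarrow>\<^sub>0 'k) set set \<Rightarrow> 'a" where
  "env_lift A f =
     quot_lift (quot_lift (lin_ext A (\<lambda>xs. foldr (\<lambda>x a. f x \<otimes>\<^bsub>A\<^esub> a) xs \<one>\<^bsub>A\<^esub>)))"


subsection \<open>Weyl algebra\<close>

definition weyl_ideal ::
  "('k::field \<Rightarrow> 'v::ab_group_add \<Rightarrow> 'v) \<Rightarrow> 'v set \<Rightarrow> ('v \<Rightarrow> 'v \<Rightarrow> 'k) \<Rightarrow>
   ('v list \<Rightarrow>\<^sub>0 'k) set set" where
  "weyl_ideal scale V \<omega> =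
     genideal (tensor_algebra scale V)
       {commutator (tensor_algebra scale V) (tensor_gen scale V v) (tensor_gen scale V w)
          \<ominus>\<^bsub>tensor_algebra scale V\<^esub> (\<omega> v w \<odot>\<^bsub>tensor_algebra scale V\<^esub> \<one>\<^bsub>tensor_algebra scale V\<^esub>)
          | v w. v \<in> V \<and> w \<in> V}"

definition weyl_algebra ::
  "('k::field \<Rightarrow> 'v::ab_group_add \<Rightarrow> 'v) \<Rightarrow> 'v set \<Rightarrow> ('v \<Rightarrow> 'v \<Rightarrow> 'k) \<Rightarrow>
   ('k, ('v list \<Rightarrow>\<^sub>0 'k) set set) module" where
  "weyl_algebra scale V \<omega> = quot_algebra (tensor_algebra scale V) (weyl_ideal scale V \<omega>)"

definition weyl_gen ::
  "('k::field \<Rightarrow> 'v::ab_group_add \<Rightarrow> 'v) \<Rightarrow> 'v set \<Rightarrow> ('v \<Rightarrow> 'v \<Rightarrow> 'k) \<Rightarrow> 'v \<Rightarrow>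
   ('v list \<Rightarrow>\<^sub>0 'k) set set" where
  "weyl_gen scale V \<omega> v =
     weyl_ideal scale V \<omega> +>\<^bsub>tensor_algebra scale V\<^esub> tensor_gen scale V v"

text \<open>The symplectic space \<open>P \<oplus> P*\<close>, with \<open>\<omega>(\<alpha>, v) = \<alpha>(v) = - \<omega>(v, \<alpha>)\<close>.\<close>

definition double_space ::
  "('k::field \<Rightarrow> 'g::ab_group_add \<Rightarrow> 'g) \<Rightarrow> 'g set \<Rightarrow> ('g \<times> ('g \<Rightarrow> 'k)) set" where
  "double_space scale P = P \<times> dual_space scale P"

definition double_scale ::
  "('k::field \<Rightarrow> 'g::ab_group_add \<Rightarrow> 'g) \<Rightarrow> 'k \<Rightarrow> 'g \<times> ('g \<Rightarrow> 'k) \<Rightarrow> 'g \<times> ('g \<Rightarrow> 'k)" where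
  "double_scale scale c = (\<lambda>(v, \<alpha>). (scale c v, \<lambda>x. c * \<alpha> x))"

definition double_form :: "'g \<times> ('g \<Rightarrow> 'k::field) \<Rightarrow> 'g \<times> ('g \<Rightarrow> 'k) \<Rightarrow> 'k" where
  "double_form = (\<lambda>(v, \<alpha>) (w, \<beta>). \<alpha> w - \<beta> v)"

definition double_weyl ::
  "('k::field \<Rightarrow> 'g::ab_group_add \<Rightarrow> 'g) \<Rightarrow> 'g set \<Rightarrow>
   ('k, (('g \<times> ('g \<Rightarrow> 'k)) list \<Rightarrow>\<^sub>0 'k) set set) module" where
  "double_weyl scale P = weyl_algebra (double_scale scale) (double_space scale P) double_form"

definition weyl_vec ::
  "('k::field \<Rightarrow> 'g::ab_group_add \<Rightarrow> 'g) \<Rightarrow> 'g set \<Rightarrow> 'g \<Rightarrow>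
   (('g \<times> ('g \<Rightarrow> 'k)) list \<Rightarrow>\<^sub>0 'k) set set" where
  "weyl_vec scale P v = weyl_gen (double_scale scale) (double_space scale P) double_form (v, 0)"

definition weyl_covec ::
  "('k::field \<Rightarrow> 'g::ab_group_add \<Rightarrow> 'g) \<Rightarrow> 'g set \<Rightarrow> ('g \<Rightarrow> 'k) \<Rightarrow>
   (('g \<times> ('g \<Rightarrow> 'k)) list \<Rightarrow>\<^sub>0 'k) set set" where
  "weyl_covec scale P \<alpha> = weyl_gen (double_scale scale) (double_space scale P) double_form (0, \<alpha>)"


section \<open>Casimir and symplectic Dirac elements\<close>

definition env_incl ::
  "('k::field \<Rightarrow> 'g::ab_group_add \<Rightarrow> 'g) \<Rightarrow> ('g \<Rightarrow> 'g \<Rightarrow> 'g) \<Rightarrow>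
   ('g list \<Rightarrow>\<^sub>0 'k) set set \<Rightarrow> ('g list \<Rightarrow>\<^sub>0 'k) set set" where
  "env_incl scale bracket = env_lift (env_algebra scale bracket UNIV) (env_gen scale bracket UNIV)"

text \<open>An element of \<open>U(L)\<close>; for the subalgebra \<open>L\<close> it becomes an element of \<open>U(g)\<close> via
  \<open>env_incl\<close>.\<close>

definition casimir_sub ::
  "('k::field \<Rightarrow> 'g::ab_group_add \<Rightarrow> 'g) \<Rightarrow> ('g \<Rightarrow> 'g \<Rightarrow> 'g) \<Rightarrow> 'g set \<Rightarrow>
   'i set \<Rightarrow> ('i \<Rightarrow> 'g) \<Rightarrow> ('i \<Rightarrow> 'g) \<Rightarrow> ('g list \<Rightarrow>\<^sub>0 'k) set set" where
  "casimir_sub scale bracket L I w w' =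
     (\<Oplus>\<^bsub>env_algebra scale bracket L\<^esub>i\<in>I.
        env_gen scale bracket L (w i) \<otimes>\<^bsub>env_algebra scale bracket L\<^esub> env_gen scale bracket L (w' i))"

definition casimir ::
  "('k::field \<Rightarrow> 'g::ab_group_add \<Rightarrow> 'g) \<Rightarrow> ('g \<Rightarrow> 'g \<Rightarrow> 'g) \<Rightarrow> 'g set \<Rightarrow>
   'i set \<Rightarrow> ('i \<Rightarrow> 'g) \<Rightarrow> ('i \<Rightarrow> 'g) \<Rightarrow>
   'j set \<Rightarrow> ('j \<Rightarrow> 'g) \<Rightarrow> ('j \<Rightarrow> 'g) \<Rightarrow> ('g list \<Rightarrow>\<^sub>0 'k) set set" where
  "casimir scale bracket L I w w' J z z' =
     env_incl scale bracket (casimir_sub scale bracket L I w w')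
     \<oplus>\<^bsub>env_algebra scale bracket UNIV\<^esub>
     (\<Oplus>\<^bsub>env_algebra scale bracket UNIV\<^esub>i\<in>J.
        env_gen scale bracket UNIV (z' i) \<otimes>\<^bsub>env_algebra scale bracket UNIV\<^esub> env_gen scale bracket UNIV (z i))"

definition env_weyl ::
  "('k::field \<Rightarrow> 'g::ab_group_add \<Rightarrow> 'g) \<Rightarrow> ('g \<Rightarrow> 'g \<Rightarrow> 'g) \<Rightarrow> 'g set \<Rightarrow> 'g set \<Rightarrow>
   ('k, (('g list \<Rightarrow>\<^sub>0 'k) set set \<times> (('g \<times> ('g \<Rightarrow> 'k)) list \<Rightarrow>\<^sub>0 'k) set set \<Rightarrow>\<^sub>0 'k) set) module" where
  "env_weyl scale bracket L P = alg_tensor (env_algebra scale bracket L) (double_weyl scale P)"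

definition env_weyl_tensor ::
  "('k::field \<Rightarrow> 'g::ab_group_add \<Rightarrow> 'g) \<Rightarrow> ('g \<Rightarrow> 'g \<Rightarrow> 'g) \<Rightarrow> 'g set \<Rightarrow> 'g set \<Rightarrow>
   ('g list \<Rightarrow>\<^sub>0 'k) set set \<Rightarrow> (('g \<times> ('g \<Rightarrow> 'k)) list \<Rightarrow>\<^sub>0 'k) set set \<Rightarrow>
   (('g list \<Rightarrow>\<^sub>0 'k) set set \<times> (('g \<times> ('g \<Rightarrow> 'k)) list \<Rightarrow>\<^sub>0 'k) set set \<Rightarrow>\<^sub>0 'k) set" where
  "env_weyl_tensor scale bracket L P =
     pure_tensor (env_algebra scale bracket L) (double_weyl scale P)"

definition env_weyl_incl ::
  "('k::field \<Rightarrow> 'g::ab_group_add \<Rightarrow> 'g) \<Rightarrow> ('g \<Rightarrow> 'g \<Rightarrow> 'g) \<Rightarrow> 'g set \<Rightarrow>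
   (('g list \<Rightarrow>\<^sub>0 'k) set set \<times> (('g \<times> ('g \<Rightarrow> 'k)) list \<Rightarrow>\<^sub>0 'k) set set \<Rightarrow>\<^sub>0 'k) set \<Rightarrow>
   (('g list \<Rightarrow>\<^sub>0 'k) set set \<times> (('g \<times> ('g \<Rightarrow> 'k)) list \<Rightarrow>\<^sub>0 'k) set set \<Rightarrow>\<^sub>0 'k) set" where
  "env_weyl_incl scale bracket P =
     alg_tensor_map (env_algebra scale bracket UNIV) (double_weyl scale P) (env_incl scale bracket) id"

definition dirac_minus ::
  "('k::field \<Rightarrow> 'g::ab_group_add \<Rightarrow> 'g) \<Rightarrow> ('g \<Rightarrow> 'g \<Rightarrow> 'g) \<Rightarrow> 'g set \<Rightarrow>
   'j set \<Rightarrow> ('j \<Rightarrow> 'g) \<Rightarrow> ('j \<Rightarrow> 'g \<Rightarrow> 'k) \<Rightarrow>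
   (('g list \<Rightarrow>\<^sub>0 'k) set set \<times> (('g \<times> ('g \<Rightarrow> 'k)) list \<Rightarrow>\<^sub>0 'k) set set \<Rightarrow>\<^sub>0 'k) set" where
  "dirac_minus scale bracket P J z zs =
     (\<Oplus>\<^bsub>env_weyl scale bracket UNIV P\<^esub>i\<in>J.
        env_weyl_tensor scale bracket UNIV P (env_gen scale bracket UNIV (z i)) (weyl_covec scale P (zs i)))"

definition dirac_plus ::
  "('k::field \<Rightarrow> 'g::ab_group_add \<Rightarrow> 'g) \<Rightarrow> ('g \<Rightarrow> 'g \<Rightarrow> 'g) \<Rightarrow> 'g set \<Rightarrow>
   'j set \<Rightarrow> ('j \<Rightarrow> 'g) \<Rightarrow> ('j \<Rightarrow> 'g) \<Rightarrow>
   (('g list \<Rightarrow>\<^sub>0 'k) set set \<times> (('g \<times> ('g \<Rightarrow> 'k)) list \<Rightarrow>\<^sub>0 'k) set set \<Rightarrow>\<^sub>0 'k) set" where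
  "dirac_plus scale bracket P J z z' =
     (\<Oplus>\<^bsub>env_weyl scale bracket UNIV P\<^esub>i\<in>J.
        env_weyl_tensor scale bracket UNIV P (env_gen scale bracket UNIV (z i)) (weyl_vec scale P (z' i)))"

definition nu ::
  "('k::field \<Rightarrow> 'g::ab_group_add \<Rightarrow> 'g) \<Rightarrow> ('g \<Rightarrow> 'g \<Rightarrow> 'g) \<Rightarrow> 'g set \<Rightarrow>
   'j set \<Rightarrow> ('j \<Rightarrow> 'g) \<Rightarrow> ('j \<Rightarrow> 'g \<Rightarrow> 'k) \<Rightarrow>
   'g \<Rightarrow> (('g \<times> ('g \<Rightarrow> 'k)) list \<Rightarrow>\<^sub>0 'k) set set" where
  "nu scale bracket P J z zs x =
     (\<Oplus>\<^bsub>double_weyl scale P\<^esub>i\<in>J.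
        weyl_vec scale P (bracket x (z i)) \<otimes>\<^bsub>double_weyl scale P\<^esub> weyl_covec scale P (zs i))"

definition Delta ::
  "('k::field \<Rightarrow> 'g::ab_group_add \<Rightarrow> 'g) \<Rightarrow> ('g \<Rightarrow> 'g \<Rightarrow> 'g) \<Rightarrow> 'g set \<Rightarrow> 'g set \<Rightarrow>
   'j set \<Rightarrow> ('j \<Rightarrow> 'g) \<Rightarrow> ('j \<Rightarrow> 'g \<Rightarrow> 'k) \<Rightarrow> 'g \<Rightarrow>
   (('g list \<Rightarrow>\<^sub>0 'k) set set \<times> (('g \<times> ('g \<Rightarrow> 'k)) list \<Rightarrow>\<^sub>0 'k) set set \<Rightarrow>\<^sub>0 'k) set" where
  "Delta scale bracket L P J z zs x =
     env_weyl_tensor scale bracket L P (env_gen scale bracket L x) \<one>\<^bsub>double_weyl scale P\<^esub>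
     \<oplus>\<^bsub>env_weyl scale bracket L P\<^esub>
     env_weyl_tensor scale bracket L P \<one>\<^bsub>env_algebra scale bracket L\<^esub> (nu scale bracket P J z zs x)"

definition nu_ext ::
  "('k::field \<Rightarrow> 'g::ab_group_add \<Rightarrow> 'g) \<Rightarrow> ('g \<Rightarrow> 'g \<Rightarrow> 'g) \<Rightarrow> 'g set \<Rightarrow>
   'j set \<Rightarrow> ('j \<Rightarrow> 'g) \<Rightarrow> ('j \<Rightarrow> 'g \<Rightarrow> 'k) \<Rightarrow>
   ('g list \<Rightarrow>\<^sub>0 'k) set set \<Rightarrow> (('g \<times> ('g \<Rightarrow> 'k)) list \<Rightarrow>\<^sub>0 'k) set set" where
  "nu_ext scale bracket P J z zs = env_lift (double_weyl scale P) (nu scale bracket P J z zs)"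

definition Delta_ext ::
  "('k::field \<Rightarrow> 'g::ab_group_add \<Rightarrow> 'g) \<Rightarrow> ('g \<Rightarrow> 'g \<Rightarrow> 'g) \<Rightarrow> 'g set \<Rightarrow> 'g set \<Rightarrow>
   'j set \<Rightarrow> ('j \<Rightarrow> 'g) \<Rightarrow> ('j \<Rightarrow> 'g \<Rightarrow> 'k) \<Rightarrow>
   ('g list \<Rightarrow>\<^sub>0 'k) set set \<Rightarrow>
   (('g list \<Rightarrow>\<^sub>0 'k) set set \<times> (('g \<times> ('g \<Rightarrow> 'k)) list \<Rightarrow>\<^sub>0 'k) set set \<Rightarrow>\<^sub>0 'k) set" where
  "Delta_ext scale bracket L P J z zs =
     env_lift (env_weyl scale bracket L P) (Delta scale bracket L P J z zs)"

end

theory Submission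
  imports Defs
begin

text \<open>
  Expand \<open>D\<^sup>+D\<^sup>- - D\<^sup>-D\<^sup>+\<close> into a double sum over \<open>J\<close> and move every covector to the right of every
  vector. The \<open>(i, j)\<close> term becomes \<open>[z\<^sub>i, z\<^sub>j] \<otimes> z\<^sup>i z\<^sub>j\<^sup>*\<close> minus the Weyl correction \<open>z\<^sub>j\<^sup>*(z\<^sup>i) z\<^sub>j z\<^sub>i \<otimes> 1\<close>.
  The corrections add up to the \<open>p\<close>-part of the Casimir element. Since \<open>ad z\<^sub>j\<close> is skew for \<open>B\<close>, the
  brackets can be transposed from the basis of \<open>p\<close> to the basis of \<open>k\<close>, which turns the main terms into
  the sum of the \<open>w\<^sub>k \<otimes> [z\<^sub>j, w\<^sup>k] z\<^sub>j\<^sup>*\<close>, and this is minus the sum of the \<open>w\<^sub>k \<otimes> \<nu>(w\<^sup>k)\<close>. For the second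
  formula, multiply out \<open>\<Delta>(w\<^sub>k) \<Delta>(w\<^sup>k)\<close>: both mixed terms contribute the same sum because the canonical
  tensor of \<open>B\<close> on \<open>k\<close> is symmetric.
\<close>


section \<open>Algebras over a field\<close>

text \<open>\<open>env_lift\<close>, \<open>alg_tensor_map\<close> and the scalar action on a
  quotient are defined through \<open>the_elem\<close> or through unions over cosets, so nothing is
  known about their values until the map underneath is shown to be constant on cosets. This shapes
  the proof: the universal properties of the monoid, tensor, enveloping and tensor product algebras
  come before any computation, and \<open>\<nu>\<close> must be shown to be a Lie morphism before
  \<open>nu_ext\<close> and \<open>Delta_ext\<close> can be evaluated. From then on every
  computation uses defining relations and expansions in dual bases. The constants of the second
  formula arise as follows. Let X be the sum of the
  \<open>w\<^sub>k \<otimes> \<nu>(w\<^sup>k)\<close>. Over U(g) the image of \<Delta>(\<Omega>(k))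
  is \<open>\<Omega>(k) \<otimes> 1 + 2 X + 1 \<otimes> \<nu>(\<Omega>(k))\<close>. Solving for X
  and substituting into the first formula adds one half of \<Omega>(k) to the coefficient 1, which
  gives 3/2, and produces the coefficients -1/2 and 1/2.\<close>

context ring
begin

text \<open>Commutation with \<open>n\<close> is a derivation. For \<open>n = \<nu> x\<close> it
  reduces the bracket with a product of a vector and a covector to two simpler brackets.\<close>

lemma commutator_mult:
  assumes "n \<in> carrier R" "p \<in> carrier R" "q \<in> carrier R"
  shows "n \<otimes> (p \<otimes> q) \<ominus> p \<otimes> q \<otimes> n = (n \<otimes> p \<ominus> p \<otimes> n) \<otimes> q \<oplus> p \<otimes> (n \<otimes> q \<ominus> q \<otimes> n)"
  using assms by algebra

text \<open>The shape is that of \<open>x \<otimes> 1 + 1 \<otimes> \<nu>(x)\<close>: elements of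
  different tensor factors commute, so their products cancel in the commutator.\<close>

lemma commutator_add:
  assumes "a \<in> carrier R" "b \<in> carrier R" "c \<in> carrier R" "d \<in> carrier R"
    and "a \<otimes> d = d \<otimes> a" "b \<otimes> c = c \<otimes> b"
  shows "(a \<oplus> b) \<otimes> (c \<oplus> d) \<ominus> (c \<oplus> d) \<otimes> (a \<oplus> b) = (a \<otimes> c \<ominus> c \<otimes> a) \<oplus> (b \<otimes> d \<ominus> d \<otimes> b)"
  using assms by algebra

lemma add_minus_add_cancel:
  assumes "a \<in> carrier R" "b \<in> carrier R" "c \<in> carrier R"
  shows "a \<oplus> b \<ominus> (b \<oplus> c) = a \<ominus> c"
  using assms by algebra

text \<open>Here \<open>k\<close> and \<open>c\<close> stand for \<Omega>(k) and the p-part of the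
  Casimir element, both tensored with 1, and \<open>x\<close> for the sum of the
  \<open>w\<^sub>k \<otimes> \<nu>(w\<^sup>k)\<close>.\<close>

lemma dirac_rearrange_1:
  assumes "k \<in> carrier R" "c \<in> carrier R" "x \<in> carrier R"
  shows "\<ominus> (k \<oplus> c) \<oplus> k \<ominus> x = \<ominus> x \<ominus> c"
  using assms by algebra

text \<open>\<open>h\<close> is half of the former \<open>k\<close>, and \<open>m\<close> is half of
  \<open>1 \<otimes> \<nu>(\<Omega>(k))\<close>. Writing multiples of 1/2 as sums of halves keeps
  scalars out of the identity.\<close>

lemma dirac_rearrange_2:
  assumes "h \<in> carrier R" "c \<in> carrier R" "x \<in> carrier R" "m \<in> carrier R"
  shows "\<ominus> (h \<oplus> h \<oplus> c) \<oplus> (h \<oplus> h \<oplus> h) \<ominus> (h \<oplus> x \<oplus> m) \<oplus> m = \<ominus> x \<ominus> c"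
  using assms by algebra

end

text \<open>Scalars form a type and elements a carrier, as in the \<open>module\<close> records of
  the definitions. The product need not commute, so that enveloping and Weyl algebras are
  covered.\<close>

locale assoc_algebra = ring A for A :: "('k::field, 'a) module" (structure) +
  assumes smult_closed [simp, intro]: "x \<in> carrier A \<Longrightarrow> c \<odot> x \<in> carrier A"
    and smult_l_distr: "x \<in> carrier A \<Longrightarrow> (c + d) \<odot> x = c \<odot> x \<oplus> d \<odot> x"
    and smult_r_distr: "x \<in> carrier A \<Longrightarrow> y \<in> carrier A \<Longrightarrow> c \<odot> (x \<oplus> y) = c \<odot> x \<oplus> c \<odot> y"
    and smult_assoc: "x \<in> carrier A \<Longrightarrow> (c * d) \<odot> x = c \<odot> (d \<odot> x)"
    and smult_one [simp]: "x \<in> carrier A \<Longrightarrow> 1 \<odot> x = x"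
    and smult_mult_left: "x \<in> carrier A \<Longrightarrow> y \<in> carrier A \<Longrightarrow> (c \<odot> x) \<otimes> y = c \<odot> (x \<otimes> y)"
    and smult_mult_right: "x \<in> carrier A \<Longrightarrow> y \<in> carrier A \<Longrightarrow> x \<otimes> (c \<odot> y) = c \<odot> (x \<otimes> y)"
begin

lemma smult_zero_right [simp]: "c \<odot> \<zero> = \<zero>"
  using smult_r_distr[of \<zero> \<zero> c] by (metis add.r_cancel_one' smult_closed zero_closed l_zero)

lemma smult_zero_left [simp]: "x \<in> carrier A \<Longrightarrow> 0 \<odot> x = \<zero>"
  using smult_l_distr[of x 0 0] by (metis add.r_cancel_one' add_0 smult_closed)

lemma smult_uminus: "x \<in> carrier A \<Longrightarrow> (- c) \<odot> x = \<ominus> (c \<odot> x)"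
  by (metis add.commute add.right_inverse minus_equality smult_closed smult_l_distr smult_zero_left)

lemma minus_eq_iff:
  "x \<in> carrier A \<Longrightarrow> y \<in> carrier A \<Longrightarrow> z \<in> carrier A \<Longrightarrow> x \<ominus> y = z \<longleftrightarrow> x = z \<oplus> y"
  by (metis add.inv_solve_right minus_eq)

lemma minus_self [simp]: "x \<in> carrier A \<Longrightarrow> x \<ominus> x = \<zero>"
  by (simp add: minus_eq r_neg)

lemma smult_finsum: "f \<in> S \<rightarrow> carrier A \<Longrightarrow> c \<odot> (\<Oplus>i\<in>S. f i) = (\<Oplus>i\<in>S. c \<odot> f i)"
proof (induction S rule: infinite_finite_induct)
  case (insert x F)
  then have "f \<in> F \<rightarrow> carrier A" "f x \<in> carrier A" by auto
  with insert show ?case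
    by (simp add: smult_r_distr Pi_def)
qed auto

lemma finsum_swap:
  assumes "finite S" "finite T" "\<And>i j. i \<in> S \<Longrightarrow> j \<in> T \<Longrightarrow> f i j \<in> carrier A"
  shows "(\<Oplus>i\<in>S. \<Oplus>j\<in>T. f i j) = (\<Oplus>j\<in>T. \<Oplus>i\<in>S. f i j)"
  using assms(1) assms(3)
proof (induction S rule: finite_induct)
  case (insert x F)
  have "(\<Oplus>i\<in>insert x F. \<Oplus>j\<in>T. f i j) = (\<Oplus>j\<in>T. f x j) \<oplus> (\<Oplus>i\<in>F. \<Oplus>j\<in>T. f i j)"
    using insert by (subst finsum_insert) (auto intro!: finsum_closed)
  also have "\<dots> = (\<Oplus>j\<in>T. f x j \<oplus> (\<Oplus>i\<in>F. f i j))"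
    using insert by (subst finsum_addf) (auto intro!: finsum_closed)
  also have "\<dots> = (\<Oplus>j\<in>T. \<Oplus>i\<in>insert x F. f i j)"
    using insert by (intro finsum_cong') (auto intro!: finsum_closed)
  finally show ?case .
qed (simp add: finsum_zero)

lemma finsum_a_inv: "f \<in> S \<rightarrow> carrier A \<Longrightarrow> (\<Oplus>i\<in>S. \<ominus> f i) = \<ominus> (\<Oplus>i\<in>S. f i)"
proof -
  assume "f \<in> S \<rightarrow> carrier A"
  moreover from this have "(\<Oplus>i\<in>S. \<ominus> f i) = (\<Oplus>i\<in>S. - 1 \<odot> f i)"
    by (intro finsum_cong') (auto simp: smult_uminus Pi_def)
  ultimately show ?thesis
    using smult_finsum[of f S "-1"] by (simp add: smult_uminus)
qed

lemma finsum_minus: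
  assumes "f \<in> S \<rightarrow> carrier A" "g \<in> S \<rightarrow> carrier A"
  shows "(\<Oplus>i\<in>S. f i \<ominus> g i) = (\<Oplus>i\<in>S. f i) \<ominus> (\<Oplus>i\<in>S. g i)"
proof -
  have "(\<lambda>i. \<ominus> g i) \<in> S \<rightarrow> carrier A" using assms by auto
  then show ?thesis
    using assms by (simp add: minus_eq finsum_addf finsum_a_inv)
qed

end

locale assoc_algebra_hom = A?: assoc_algebra A + B: assoc_algebra A'
  for A :: "('k::field, 'a) module" (structure) and A' :: "('k, 'b) module" and h +
  assumes hom: "h \<in> ring_hom A A'"
    and hom_smult: "x \<in> carrier A \<Longrightarrow> h (c \<odot> x) = c \<odot>\<^bsub>A'\<^esub> h x"
begin

lemmas hom_closed [simp] = ring_hom_memE(1)[OF hom]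
lemmas hom_mult = ring_hom_memE(2)[OF hom]
lemmas hom_add = ring_hom_memE(3)[OF hom]
lemmas hom_one = ring_hom_memE(4)[OF hom]

lemma hom_zero: "h \<zero> = \<zero>\<^bsub>A'\<^esub>"
  using hom_smult[of \<zero> 0] by simp

lemma hom_a_inv: "x \<in> carrier A \<Longrightarrow> h (\<ominus> x) = \<ominus>\<^bsub>A'\<^esub> h x"
  using hom_smult[of x "-1"] by (simp add: smult_uminus B.smult_uminus)

lemma hom_minus: "x \<in> carrier A \<Longrightarrow> y \<in> carrier A \<Longrightarrow> h (x \<ominus> y) = h x \<ominus>\<^bsub>A'\<^esub> h y"
  by (simp add: minus_eq B.minus_eq hom_add hom_a_inv)

lemma hom_finsum: "f \<in> S \<rightarrow> carrier A \<Longrightarrow> h (\<Oplus>i\<in>S. f i) = (\<Oplus>\<^bsub>A'\<^esub>i\<in>S. h (f i))"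
proof (induction S rule: infinite_finite_induct)
  case (insert x F)
  then have "f \<in> F \<rightarrow> carrier A" "f x \<in> carrier A" by auto
  with insert show ?case by (simp add: hom_add Pi_def)
qed (auto simp: hom_zero)

text \<open>The kernel of \<open>h\<close> is a two-sided ideal, so it contains the ideal generated
  by any of its subsets. Each later descent to a quotient is thereby checked on the generating
  relations.\<close>

lemma hom_genideal:
  assumes "S \<subseteq> carrier A" "\<And>x. x \<in> S \<Longrightarrow> h x = \<zero>\<^bsub>A'\<^esub>" "x \<in> genideal A S"
  shows "h x = \<zero>\<^bsub>A'\<^esub>"
proof -
  have "ring_hom_ring A A' h"
    by (rule ring_hom_ringI2) (simp_all add: A.ring_axioms B.ring_axioms hom)
  then have "ideal (a_kernel A A' h) A"
    by (rule ring_hom_ring.kernel_is_ideal)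
  moreover have "S \<subseteq> a_kernel A A' h"
    using assms by (auto simp: a_kernel_def')
  ultimately have "genideal A S \<subseteq> a_kernel A A' h"
    by (rule genideal_minimal)
  with assms(3) show ?thesis
    by (auto simp: a_kernel_def')
qed

end

context assoc_algebra
begin

lemma commutator_finsum_left:
  assumes "finite S" "f \<in> S \<rightarrow> carrier A" "b \<in> carrier A"
  shows "(\<Oplus>i\<in>S. f i) \<otimes> b \<ominus> b \<otimes> (\<Oplus>i\<in>S. f i) = (\<Oplus>i\<in>S. f i \<otimes> b \<ominus> b \<otimes> f i)"
  using assms by (subst finsum_minus) (auto simp: finsum_ldistr finsum_rdistr)

lemma commutator_finsum_right:
  assumes "finite S" "f \<in> S \<rightarrow> carrier A" "b \<in> carrier A"
  shows "b \<otimes> (\<Oplus>i\<in>S. f i) \<ominus> (\<Oplus>i\<in>S. f i) \<otimes> b = (\<Oplus>i\<in>S. b \<otimes> f i \<ominus> f i \<otimes> b)"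
  using assms by (subst finsum_minus) (auto simp: finsum_ldistr finsum_rdistr)

lemma mult_finsum_smult:
  assumes "finite S" "f \<in> S \<rightarrow> carrier A" "b \<in> carrier A"
  shows "b \<otimes> (\<Oplus>i\<in>S. r i \<odot> f i) = (\<Oplus>i\<in>S. r i \<odot> (b \<otimes> f i))"
    and "(\<Oplus>i\<in>S. r i \<odot> f i) \<otimes> b = (\<Oplus>i\<in>S. r i \<odot> (f i \<otimes> b))"
proof -
  have f: "\<And>i. i \<in> S \<Longrightarrow> f i \<in> carrier A" using assms(2) by auto
  have "b \<otimes> (\<Oplus>i\<in>S. r i \<odot> f i) = (\<Oplus>i\<in>S. b \<otimes> (r i \<odot> f i))"
    using assms f by (intro finsum_rdistr) auto
  also have "\<dots> = (\<Oplus>i\<in>S. r i \<odot> (b \<otimes> f i))"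
    using assms(3) f by (intro finsum_cong' refl) (auto simp: smult_mult_right)
  finally show "b \<otimes> (\<Oplus>i\<in>S. r i \<odot> f i) = (\<Oplus>i\<in>S. r i \<odot> (b \<otimes> f i))" .
  have "(\<Oplus>i\<in>S. r i \<odot> f i) \<otimes> b = (\<Oplus>i\<in>S. (r i \<odot> f i) \<otimes> b)"
    using assms f by (intro finsum_ldistr) auto
  also have "\<dots> = (\<Oplus>i\<in>S. r i \<odot> (f i \<otimes> b))"
    using assms(3) f by (intro finsum_cong' refl) (auto simp: smult_mult_left)
  finally show "(\<Oplus>i\<in>S. r i \<odot> f i) \<otimes> b = (\<Oplus>i\<in>S. r i \<odot> (f i \<otimes> b))" .
qed

end

lemma (in assoc_algebra_hom) hom_finsum_mult:
  assumes "f \<in> S \<rightarrow> carrier A" "g \<in> S \<rightarrow> carrier A"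
  shows "h (\<Oplus>i\<in>S. f i \<otimes> g i) = (\<Oplus>\<^bsub>A'\<^esub>i\<in>S. h (f i) \<otimes>\<^bsub>A'\<^esub> h (g i))"
proof -
  have fg: "\<And>i. i \<in> S \<Longrightarrow> f i \<in> carrier A" "\<And>i. i \<in> S \<Longrightarrow> g i \<in> carrier A" using assms by auto
  then have "h (\<Oplus>i\<in>S. f i \<otimes> g i) = (\<Oplus>\<^bsub>A'\<^esub>i\<in>S. h (f i \<otimes> g i))"
    by (intro hom_finsum) auto
  also have "\<dots> = (\<Oplus>\<^bsub>A'\<^esub>i\<in>S. h (f i) \<otimes>\<^bsub>A'\<^esub> h (g i))"
    using fg by (intro B.finsum_cong' refl) (auto simp: hom_mult)
  finally show ?thesis .
qed

text \<open>The sum \<open>k \<oplus> (x \<oplus> x) \<oplus> n\<close> is the shape of the image of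
  \<Delta>(\<Omega>(k)). Half of it removes the surplus half of \<open>k\<close> and the added half
  of \<open>n\<close>, and leaves \<open>x\<close> once.\<close>

lemma (in assoc_algebra) dirac_rearrange_half:
  assumes "k \<in> carrier A" "c \<in> carrier A" "x \<in> carrier A" "n \<in> carrier A" "(2::'k) \<noteq> 0"
  shows "\<ominus> (k \<oplus> c) \<oplus> (3/2) \<odot> k \<ominus> (1/2) \<odot> (k \<oplus> (x \<oplus> x) \<oplus> n) \<oplus> (1/2) \<odot> n = \<ominus> x \<ominus> c"
proof -
  have half: "(1/2) \<odot> y \<oplus> (1/2) \<odot> y = y" if "y \<in> carrier A" for y
  proof -
    have "(1/2 + 1/2 :: 'k) = 1" using assms(5) by (simp add: field_simps)
    then show ?thesis using that by (simp flip: smult_l_distr)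
  qed
  define h where "h = (1/2) \<odot> k"
  have h: "h \<in> carrier A" "k = h \<oplus> h" using assms by (simp_all add: h_def half)
  have "(3/2 :: 'k) = 1/2 + 1/2 + 1/2" using assms(5) by (simp add: field_simps)
  then have "(3/2) \<odot> k = h \<oplus> h \<oplus> h"
    using assms by (simp only: smult_l_distr h_def)
  moreover have "(1/2) \<odot> (k \<oplus> (x \<oplus> x) \<oplus> n) = h \<oplus> x \<oplus> (1/2) \<odot> n"
    using assms by (simp add: smult_r_distr half h_def)
  ultimately show ?thesis
    using dirac_rearrange_2[of h c x "(1/2) \<odot> n"] h assms by simp
qed


section \<open>Monoid algebras\<close>

text \<open>The support bound is part of the induction because the laws of a \<open>monoid\<close>
  hold on its carrier only. Partial sums of the monomials of \<open>p\<close> preserve both the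
  bound and \<open>P\<close>.\<close>

lemma poly_mapping_induct_on [consumes 1, case_names zero single add]:
  fixes p :: "'m \<Rightarrow>\<^sub>0 'k::comm_monoid_add"
  assumes "Poly_Mapping.keys p \<subseteq> C" and "P 0"
    and single: "\<And>a c. a \<in> C \<Longrightarrow> P (Poly_Mapping.single a c)"
    and add: "\<And>p q. Poly_Mapping.keys p \<subseteq> C \<Longrightarrow> Poly_Mapping.keys q \<subseteq> C \<Longrightarrow> P p \<Longrightarrow> P q \<Longrightarrow> P (p + q)"
  shows "P p"
proof -
  have "Poly_Mapping.keys (\<Sum>a\<in>S. Poly_Mapping.single a (Poly_Mapping.lookup p a)) \<subseteq> C
      \<and> P (\<Sum>a\<in>S. Poly_Mapping.single a (Poly_Mapping.lookup p a))" if "finite S" "S \<subseteq> C" for S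
    using that
  proof (induction S rule: finite_induct)
    case (insert x F)
    have "Poly_Mapping.keys (Poly_Mapping.single x (Poly_Mapping.lookup p x)) \<subseteq> C"
      using insert by auto
    with insert show ?case
      using keys_add[of "Poly_Mapping.single x (Poly_Mapping.lookup p x)"]
      by (auto intro!: single add)
  qed (use assms in auto)
  moreover have "(\<Sum>a\<in>Poly_Mapping.keys p. Poly_Mapping.single a (Poly_Mapping.lookup p a)) = p"
    by (rule poly_mapping_eqI) (auto simp: lookup_sum lookup_single when_def sum.delta in_keys_iff)
  ultimately show ?thesis
    using assms(1) by (metis finite_keys)
qed

context
  fixes M :: "('m, 'e) monoid_scheme" and MA :: "('k::field, 'm \<Rightarrow>\<^sub>0 'k) module"
  defines "MA \<equiv> monoid_algebra M"
begin

lemma monoid_algebra_simps: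
  "carrier MA = {f. Poly_Mapping.keys f \<subseteq> carrier M}"
  "\<one>\<^bsub>MA\<^esub> = Poly_Mapping.single \<one>\<^bsub>M\<^esub> 1"
  "\<zero>\<^bsub>MA\<^esub> = 0"
  "f \<oplus>\<^bsub>MA\<^esub> g = f + g"
  "c \<odot>\<^bsub>MA\<^esub> f = Poly_Mapping.map ((*) c) f"
  by (simp_all add: MA_def monoid_algebra_def)

text \<open>The definition sums over exact supports, and these can shrink under addition. Larger
  index sets make products with different supports comparable, which distributivity
  requires.\<close>

lemma monoid_algebra_mult:
  assumes "finite S" "finite T" "Poly_Mapping.keys f \<subseteq> S" "Poly_Mapping.keys g \<subseteq> T"
  shows "f \<otimes>\<^bsub>MA\<^esub> g = (\<Sum>a\<in>S. \<Sum>b\<in>T.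
    Poly_Mapping.single (a \<otimes>\<^bsub>M\<^esub> b) (Poly_Mapping.lookup f a * Poly_Mapping.lookup g b))"
proof -
  have "f \<otimes>\<^bsub>MA\<^esub> g = (\<Sum>a\<in>Poly_Mapping.keys f. \<Sum>b\<in>Poly_Mapping.keys g.
    Poly_Mapping.single (a \<otimes>\<^bsub>M\<^esub> b) (Poly_Mapping.lookup f a * Poly_Mapping.lookup g b))"
    by (simp add: MA_def monoid_algebra_def)
  also have "\<dots> = (\<Sum>a\<in>Poly_Mapping.keys f. \<Sum>b\<in>T.
    Poly_Mapping.single (a \<otimes>\<^bsub>M\<^esub> b) (Poly_Mapping.lookup f a * Poly_Mapping.lookup g b))"
    using assms by (intro sum.cong refl sum.mono_neutral_left) (auto simp: in_keys_iff)
  also have "\<dots> = (\<Sum>a\<in>S. \<Sum>b\<in>T.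
    Poly_Mapping.single (a \<otimes>\<^bsub>M\<^esub> b) (Poly_Mapping.lookup f a * Poly_Mapping.lookup g b))"
    using assms by (intro sum.mono_neutral_left) (auto simp: in_keys_iff)
  finally show ?thesis .
qed

lemma monoid_algebra_mult_single:
  "Poly_Mapping.single a c \<otimes>\<^bsub>MA\<^esub> Poly_Mapping.single b d = Poly_Mapping.single (a \<otimes>\<^bsub>M\<^esub> b) (c * d)"
  by (subst monoid_algebra_mult[of "{a}" "{b}"]) auto

lemma monoid_algebra_distrib:
  "(f + f') \<otimes>\<^bsub>MA\<^esub> g = f \<otimes>\<^bsub>MA\<^esub> g + f' \<otimes>\<^bsub>MA\<^esub> g"
  "g \<otimes>\<^bsub>MA\<^esub> (f + f') = g \<otimes>\<^bsub>MA\<^esub> f + g \<otimes>\<^bsub>MA\<^esub> f'"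
  using keys_add[of f f']
  by (simp_all add: lookup_add single_add distrib_left distrib_right sum.distrib
      monoid_algebra_mult[of "Poly_Mapping.keys f \<union> Poly_Mapping.keys f'" "Poly_Mapping.keys g"]
      monoid_algebra_mult[of "Poly_Mapping.keys g" "Poly_Mapping.keys f \<union> Poly_Mapping.keys f'"])

lemma monoid_algebra_mult_zero: "0 \<otimes>\<^bsub>MA\<^esub> f = 0" "f \<otimes>\<^bsub>MA\<^esub> 0 = 0"
  by (simp_all add: MA_def monoid_algebra_def)

lemma lookup_map_mult: "Poly_Mapping.lookup (Poly_Mapping.map ((*) (c::'k)) f) a = c * Poly_Mapping.lookup f a"
  by (simp add: map.rep_eq when_def)

lemma map_mult_laws:
  fixes c d :: 'k
  shows "Poly_Mapping.map ((*) c) 0 = 0"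
    "Poly_Mapping.map ((*) c) (f + g) = Poly_Mapping.map ((*) c) f + Poly_Mapping.map ((*) c) g"
    "Poly_Mapping.map ((*) (c + d)) f = Poly_Mapping.map ((*) c) f + Poly_Mapping.map ((*) d) f"
    "Poly_Mapping.map ((*) (c * d)) f = Poly_Mapping.map ((*) c) (Poly_Mapping.map ((*) d) f)"
    "Poly_Mapping.map ((*) 1) f = (f :: 'm \<Rightarrow>\<^sub>0 'k)"
  by (rule poly_mapping_eqI; simp add: lookup_map_mult lookup_add distrib_left distrib_right mult.assoc)+

text \<open>Associativity, the unit laws and the compatibility with scalars are additive in each
  argument. Nested inductions reduce them to monomials, where they are laws of \<open>M\<close> and
  of the field.\<close>

lemma assoc_algebra_monoid_algebra:
  assumes "monoid M"
  shows "assoc_algebra MA"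
proof -
  interpret M: monoid M by fact
  have keys_mult: "Poly_Mapping.keys (f \<otimes>\<^bsub>MA\<^esub> g) \<subseteq> carrier M"
    if "Poly_Mapping.keys f \<subseteq> carrier M" "Poly_Mapping.keys g \<subseteq> carrier M" for f g
  proof -
    have "Poly_Mapping.keys (f \<otimes>\<^bsub>MA\<^esub> g) \<subseteq>
      (\<Union>a\<in>Poly_Mapping.keys f. \<Union>b\<in>Poly_Mapping.keys g. {a \<otimes>\<^bsub>M\<^esub> b})"
      unfolding monoid_algebra_mult[OF finite_keys finite_keys order_refl order_refl]
      by (intro order_trans[OF keys_sum] UN_mono order_refl) auto
    also have "\<dots> \<subseteq> carrier M" using that by blast
    finally show ?thesis .
  qed
  have assoc: "f \<otimes>\<^bsub>MA\<^esub> g \<otimes>\<^bsub>MA\<^esub> h = f \<otimes>\<^bsub>MA\<^esub> (g \<otimes>\<^bsub>MA\<^esub> h)"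
    if "Poly_Mapping.keys f \<subseteq> carrier M" "Poly_Mapping.keys g \<subseteq> carrier M" "Poly_Mapping.keys h \<subseteq> carrier M" for f g h
    using that(1)
  proof (induction rule: poly_mapping_induct_on)
    case (single a c)
    from that(2) show ?case
    proof (induction rule: poly_mapping_induct_on)
      case (single b d)
      from that(3) show ?case
      proof (induction rule: poly_mapping_induct_on)
        case (single e r)
        with \<open>a \<in> carrier M\<close> \<open>b \<in> carrier M\<close> show ?case
          by (simp add: monoid_algebra_mult_single M.m_assoc mult.assoc)
      qed (simp_all add: monoid_algebra_distrib monoid_algebra_mult_zero)
    qed (simp_all add: monoid_algebra_distrib monoid_algebra_mult_zero)
  qed (simp_all add: monoid_algebra_distrib monoid_algebra_mult_zero)
  have one: "Poly_Mapping.single \<one>\<^bsub>M\<^esub> 1 \<otimes>\<^bsub>MA\<^esub> f = f" "f \<otimes>\<^bsub>MA\<^esub> Poly_Mapping.single \<one>\<^bsub>M\<^esub> 1 = f"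
    if "Poly_Mapping.keys f \<subseteq> carrier M" for f
    using that
    by (induction rule: poly_mapping_induct_on)
      (simp_all add: monoid_algebra_distrib monoid_algebra_mult_zero monoid_algebra_mult_single)
  have smult: "Poly_Mapping.map ((*) c) f \<otimes>\<^bsub>MA\<^esub> g = Poly_Mapping.map ((*) c) (f \<otimes>\<^bsub>MA\<^esub> g)"
      "f \<otimes>\<^bsub>MA\<^esub> Poly_Mapping.map ((*) c) g = Poly_Mapping.map ((*) c) (f \<otimes>\<^bsub>MA\<^esub> g)"
    if "Poly_Mapping.keys f \<subseteq> carrier M" "Poly_Mapping.keys g \<subseteq> carrier M" for f g c
  proof -
    have "Poly_Mapping.map ((*) c) f \<otimes>\<^bsub>MA\<^esub> g = Poly_Mapping.map ((*) c) (f \<otimes>\<^bsub>MA\<^esub> g) \<and>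
      f \<otimes>\<^bsub>MA\<^esub> Poly_Mapping.map ((*) c) g = Poly_Mapping.map ((*) c) (f \<otimes>\<^bsub>MA\<^esub> g)"
      using that(1)
    proof (induction rule: poly_mapping_induct_on)
      case (single a d)
      from that(2) show ?case
        by (induction rule: poly_mapping_induct_on)
          (simp_all add: monoid_algebra_distrib monoid_algebra_mult_zero monoid_algebra_mult_single
            map_single map_mult_laws mult.assoc mult.left_commute[of d c])
    qed (simp_all add: monoid_algebra_distrib monoid_algebra_mult_zero map_mult_laws)
    then show "Poly_Mapping.map ((*) c) f \<otimes>\<^bsub>MA\<^esub> g = Poly_Mapping.map ((*) c) (f \<otimes>\<^bsub>MA\<^esub> g)"
      "f \<otimes>\<^bsub>MA\<^esub> Poly_Mapping.map ((*) c) g = Poly_Mapping.map ((*) c) (f \<otimes>\<^bsub>MA\<^esub> g)" by auto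
  qed
  have map_keys: "Poly_Mapping.keys (Poly_Mapping.map ((*) c) f) \<subseteq> Poly_Mapping.keys f" for c and f :: "'m \<Rightarrow>\<^sub>0 'k"
    by (auto simp: in_keys_iff lookup_map_mult)
  show ?thesis
  proof (intro assoc_algebra.intro ringI abelian_groupI monoidI assoc_algebra_axioms.intro)
    fix f g :: "'m \<Rightarrow>\<^sub>0 'k"
    show "f \<in> carrier MA \<Longrightarrow> \<exists>y\<in>carrier MA. y \<oplus>\<^bsub>MA\<^esub> f = \<zero>\<^bsub>MA\<^esub>"
      by (rule bexI[of _ "- f"]) (auto simp: monoid_algebra_simps in_keys_iff)
    show "f \<in> carrier MA \<Longrightarrow> g \<in> carrier MA \<Longrightarrow> f \<oplus>\<^bsub>MA\<^esub> g \<in> carrier MA"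
      using keys_add[of f g] by (auto simp: monoid_algebra_simps)
    show "f \<in> carrier MA \<Longrightarrow> c \<odot>\<^bsub>MA\<^esub> f \<in> carrier MA" for c
      using map_keys[of c f] by (auto simp: monoid_algebra_simps)
    show "f \<in> carrier MA \<Longrightarrow> g \<in> carrier MA \<Longrightarrow> f \<otimes>\<^bsub>MA\<^esub> g \<in> carrier MA"
      by (simp add: monoid_algebra_simps keys_mult)
  qed (simp_all add: monoid_algebra_simps assoc one smult monoid_algebra_distrib add_ac map_mult_laws)
qed

end

text \<open>Brings summands with different supports to one index set, so that
  \<open>lin_ext_add\<close> can compare the sums termwise.\<close>

lemma lin_ext_superset:
  assumes "assoc_algebra A" "\<phi> \<in> C \<rightarrow> carrier A" "finite S" "Poly_Mapping.keys p \<subseteq> S" "S \<subseteq> C"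
  shows "lin_ext A \<phi> p = (\<Oplus>\<^bsub>A\<^esub>m\<in>S. Poly_Mapping.lookup p m \<odot>\<^bsub>A\<^esub> \<phi> m)"
proof -
  interpret assoc_algebra A by fact
  show ?thesis
    unfolding lin_ext_def using assms(2-)
    by (intro add.finprod_mono_neutral_cong_left[folded finsum_def]) (auto simp: in_keys_iff Pi_def subset_iff)
qed

lemma lin_ext_closed:
  assumes "assoc_algebra A" "\<phi> \<in> C \<rightarrow> carrier A" "Poly_Mapping.keys p \<subseteq> C"
  shows "lin_ext A \<phi> p \<in> carrier A"
proof -
  interpret assoc_algebra A by fact
  show ?thesis
    unfolding lin_ext_def using assms(2-) by (intro finsum_closed) auto
qed

lemma lin_ext_single:
  assumes "assoc_algebra A" "\<phi> \<in> C \<rightarrow> carrier A" "m \<in> C"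
  shows "lin_ext A \<phi> (Poly_Mapping.single m c) = c \<odot>\<^bsub>A\<^esub> \<phi> m"
proof -
  interpret assoc_algebra A by fact
  have "\<phi> m \<in> carrier A" using assms by auto
  then show ?thesis
    using assms by (subst lin_ext_superset[OF assms(1,2), of "{m}"]) auto
qed

lemma lin_ext_add:
  assumes "assoc_algebra A" "\<phi> \<in> C \<rightarrow> carrier A" "Poly_Mapping.keys p \<subseteq> C" "Poly_Mapping.keys q \<subseteq> C"
  shows "lin_ext A \<phi> (p + q) = lin_ext A \<phi> p \<oplus>\<^bsub>A\<^esub> lin_ext A \<phi> q"
proof -
  interpret assoc_algebra A by fact
  let ?S = "Poly_Mapping.keys p \<union> Poly_Mapping.keys q"
  have c: "\<phi> m \<in> carrier A" if "m \<in> ?S" for m using that assms by auto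
  have "lin_ext A \<phi> (p + q) = (\<Oplus>\<^bsub>A\<^esub>m\<in>?S. Poly_Mapping.lookup (p + q) m \<odot>\<^bsub>A\<^esub> \<phi> m)"
    using assms keys_add[of p q] by (intro lin_ext_superset[OF assms(1,2)]) auto
  also have "\<dots> = (\<Oplus>\<^bsub>A\<^esub>m\<in>?S. Poly_Mapping.lookup p m \<odot>\<^bsub>A\<^esub> \<phi> m \<oplus>\<^bsub>A\<^esub> Poly_Mapping.lookup q m \<odot>\<^bsub>A\<^esub> \<phi> m)"
    using c by (intro finsum_cong') (auto simp: lookup_add smult_l_distr)
  also have "\<dots> = (\<Oplus>\<^bsub>A\<^esub>m\<in>?S. Poly_Mapping.lookup p m \<odot>\<^bsub>A\<^esub> \<phi> m) \<oplus>\<^bsub>A\<^esub> (\<Oplus>\<^bsub>A\<^esub>m\<in>?S. Poly_Mapping.lookup q m \<odot>\<^bsub>A\<^esub> \<phi> m)"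
    using c by (intro finsum_addf) auto
  also have "\<dots> = lin_ext A \<phi> p \<oplus>\<^bsub>A\<^esub> lin_ext A \<phi> q"
    using assms by (subst (1 2) lin_ext_superset[OF assms(1,2), of ?S]) auto
  finally show ?thesis .
qed

text \<open>Universal property of the monoid algebra. Both sides of the product rule are biadditive,
  so monomials suffice.\<close>

lemma lin_ext_hom:
  fixes A :: "('k::field, 'a) module"
  assumes "monoid M" "assoc_algebra A"
    and closed: "\<phi> \<in> carrier M \<rightarrow> carrier A"
    and mult: "\<And>a b. a \<in> carrier M \<Longrightarrow> b \<in> carrier M \<Longrightarrow> \<phi> (a \<otimes>\<^bsub>M\<^esub> b) = \<phi> a \<otimes>\<^bsub>A\<^esub> \<phi> b"
    and one: "\<phi> \<one>\<^bsub>M\<^esub> = \<one>\<^bsub>A\<^esub>"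
  shows "assoc_algebra_hom (monoid_algebra M) A (lin_ext A \<phi>)"
proof -
  interpret M: monoid M by fact
  interpret A: assoc_algebra A by fact
  interpret MA: assoc_algebra "monoid_algebra M" by (rule assoc_algebra_monoid_algebra) fact
  note simps = monoid_algebra_simps
  note [simp] = lin_ext_single[OF assms(2) closed] lin_ext_add[OF assms(2) closed] lin_ext_closed[OF assms(2) closed]
  have [simp]: "lin_ext A \<phi> 0 = \<zero>\<^bsub>A\<^esub>" by (simp add: lin_ext_def)
  have c: "a \<in> carrier M \<Longrightarrow> \<phi> a \<in> carrier A" for a using closed by auto
  have car: "f \<in> carrier (monoid_algebra M) \<longleftrightarrow> Poly_Mapping.keys f \<subseteq> carrier M" for f :: "_ \<Rightarrow>\<^sub>0 'k"
    by (simp add: simps)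
  have keys_mult: "Poly_Mapping.keys f \<subseteq> carrier M \<Longrightarrow> Poly_Mapping.keys g \<subseteq> carrier M \<Longrightarrow>
    Poly_Mapping.keys (f \<otimes>\<^bsub>monoid_algebra M\<^esub> g) \<subseteq> carrier M" for f g :: "_ \<Rightarrow>\<^sub>0 'k"
    using MA.m_closed[of f g] by (simp add: simps)
  show ?thesis
  proof (intro assoc_algebra_hom.intro assoc_algebra_hom_axioms.intro ring_hom_memI A.assoc_algebra_axioms MA.assoc_algebra_axioms)
    fix f g :: "_ \<Rightarrow>\<^sub>0 'k"
    assume "f \<in> carrier (monoid_algebra M)" "g \<in> carrier (monoid_algebra M)"
    then have f: "Poly_Mapping.keys f \<subseteq> carrier M" and g: "Poly_Mapping.keys g \<subseteq> carrier M"
      by (simp_all add: car)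
    from f show "lin_ext A \<phi> (f \<otimes>\<^bsub>monoid_algebra M\<^esub> g) = lin_ext A \<phi> f \<otimes>\<^bsub>A\<^esub> lin_ext A \<phi> g"
    proof (induction rule: poly_mapping_induct_on)
      case (single a d)
      from g show ?case
      proof (induction rule: poly_mapping_induct_on)
        case (single b e)
        then show ?case using \<open>a \<in> carrier M\<close>
          by (simp add: monoid_algebra_mult_single c mult A.smult_mult_left A.smult_mult_right
              mult.commute[of d e] A.smult_assoc)
      qed (use single in \<open>simp_all add: monoid_algebra_distrib monoid_algebra_mult_zero keys_mult A.r_distr c\<close>)
    qed (use g in \<open>simp_all add: monoid_algebra_distrib monoid_algebra_mult_zero keys_mult A.l_distr\<close>)
  next
    fix f :: "_ \<Rightarrow>\<^sub>0 'k" and r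
    assume "f \<in> carrier (monoid_algebra M)"
    then have f: "Poly_Mapping.keys f \<subseteq> carrier M" by (simp add: car)
    \<comment> \<open>The support bound is carried along because \<open>lin_ext_add\<close> asks for
      it on the scaled summands.\<close>
    then have "Poly_Mapping.keys (Poly_Mapping.map ((*) r) f) \<subseteq> carrier M \<and> lin_ext A \<phi> (Poly_Mapping.map ((*) r) f) = r \<odot>\<^bsub>A\<^esub> lin_ext A \<phi> f"
    proof (induction rule: poly_mapping_induct_on)
      case (add p q)
      then show ?case
        using keys_add[of "Poly_Mapping.map ((*) r) p" "Poly_Mapping.map ((*) r) q"]
        by (auto simp add: map_mult_laws A.smult_r_distr)
    qed (auto simp: c A.smult_assoc map_mult_laws)
    then show "lin_ext A \<phi> (r \<odot>\<^bsub>monoid_algebra M\<^esub> f) = r \<odot>\<^bsub>A\<^esub> lin_ext A \<phi> f"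
      by (simp add: simps)
  qed (auto simp: simps one)
qed


section \<open>Quotient algebras\<close>

context assoc_algebra
begin

context
  fixes I :: "'a set"
  assumes I: "ideal I A"
begin

interpretation I: ideal I A by (rule I)

lemma quot_algebra_simps:
  "carrier (quot_algebra A I) = a_rcosets I"
  "X \<otimes>\<^bsub>quot_algebra A I\<^esub> Y = rcoset_mult A I X Y"
  "X \<oplus>\<^bsub>quot_algebra A I\<^esub> Y = X <+> Y"
  "\<one>\<^bsub>quot_algebra A I\<^esub> = I +> \<one>"
  "\<zero>\<^bsub>quot_algebra A I\<^esub> = I"
  "c \<odot>\<^bsub>quot_algebra A I\<^esub> X = (\<Union>x\<in>X. I +> (c \<odot> x))"
  by (simp_all add: quot_algebra_def FactRing_def ring.defs module.defs)

text \<open>The scalar action is a union over all representatives of a coset. It is a single coset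
  because every representative contributes the same one.\<close>

lemma rcos_smult: "y \<in> carrier A \<Longrightarrow> c \<odot>\<^bsub>quot_algebra A I\<^esub> (I +> y) = I +> (c \<odot> y)"
proof -
  assume y: "y \<in> carrier A"
  have "I +> (c \<odot> x) = I +> (c \<odot> y)" if x: "x \<in> I +> y" for x
  proof -
    from x obtain i where i: "i \<in> I" "x = i \<oplus> y"
      by (auto simp: a_r_coset_def')
    then have c: "i \<in> carrier A" by (simp add: I.a_Hcarr)
    \<comment> \<open>A ring ideal absorbs products; the unit turns scaling into a product, so the
      ideal absorbs scalars too.\<close>
    have "c \<odot> i = (c \<odot> \<one>) \<otimes> i"
      using c by (simp add: smult_mult_left)
    then have "c \<odot> i \<in> I"
      using i by (simp add: I.I_l_closed)
    have "I +> (c \<odot> i \<oplus> c \<odot> y) = (I +> (c \<odot> i)) +> (c \<odot> y)"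
      using c y by (simp add: a_coset_add_assoc I.a_subset)
    with \<open>c \<odot> i \<in> I\<close> c y i show ?thesis
      by (simp add: smult_r_distr I.a_rcos_const)
  qed
  moreover have "y \<in> I +> y" using y by (rule I.a_rcos_self)
  ultimately have "(\<Union>x\<in>I +> y. I +> (c \<odot> x)) = I +> (c \<odot> y)" by blast
  then show ?thesis by (simp only: quot_algebra_simps)
qed

lemma rcosets_cases:
  assumes "X \<in> carrier (quot_algebra A I)"
  obtains x where "x \<in> carrier A" "X = I +> x"
  using assms by (auto simp: quot_algebra_simps A_RCOSETS_def')

lemma rcos_ops:
  "x \<in> carrier A \<Longrightarrow> I +> x \<in> carrier (quot_algebra A I)"
  "x \<in> carrier A \<Longrightarrow> y \<in> carrier A \<Longrightarrow> (I +> x) \<otimes>\<^bsub>quot_algebra A I\<^esub> (I +> y) = I +> (x \<otimes> y)"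
  "x \<in> carrier A \<Longrightarrow> y \<in> carrier A \<Longrightarrow> (I +> x) \<oplus>\<^bsub>quot_algebra A I\<^esub> (I +> y) = I +> (x \<oplus> y)"
  by (simp_all add: quot_algebra_simps I.rcoset_mult_add I.a_rcos_sum a_rcosetsI I.a_subset)

lemma assoc_algebra_quot: "assoc_algebra (quot_algebra A I)"
proof -
  interpret Q: ring "A Quot I" by (rule I.quotient_is_ring)
  have "ring (quot_algebra A I)"
  proof (intro ringI abelian_groupI monoidI)
    fix X assume "X \<in> carrier (quot_algebra A I)"
    then obtain x where x: "x \<in> carrier A" "X = I +> x" by (rule rcosets_cases)
    then show "\<exists>Y\<in>carrier (quot_algebra A I). Y \<oplus>\<^bsub>quot_algebra A I\<^esub> X = \<zero>\<^bsub>quot_algebra A I\<^esub>"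
      by (intro bexI[of _ "I +> (\<ominus> x)"])
        (simp_all add: rcos_ops l_neg quot_algebra_simps(5) a_coset_add_zero I.a_subset)
  next
    show "\<zero>\<^bsub>quot_algebra A I\<^esub> \<oplus>\<^bsub>quot_algebra A I\<^esub> X = X" if "X \<in> carrier (quot_algebra A I)" for X
      using Q.l_zero[of X] that by (simp add: quot_algebra_simps FactRing_def)
    show "\<zero>\<^bsub>quot_algebra A I\<^esub> \<in> carrier (quot_algebra A I)"
      using Q.zero_closed by (simp add: quot_algebra_simps FactRing_def)
  qed (auto elim!: rcosets_cases simp: rcos_ops quot_algebra_simps(4) m_assoc a_ac l_distr r_distr)
  then show ?thesis
    by (intro assoc_algebra.intro assoc_algebra_axioms.intro)
      (auto elim!: rcosets_cases simp: rcos_ops rcos_smult smult_l_distr smult_r_distr smult_assoc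
        smult_mult_left smult_mult_right)
qed

lemma rcos_hom: "assoc_algebra_hom A (quot_algebra A I) (\<lambda>x. I +> x)"
  by (intro assoc_algebra_hom.intro assoc_algebra_hom_axioms.intro assoc_algebra_axioms assoc_algebra_quot ring_hom_memI)
    (simp_all add: rcos_ops rcos_smult quot_algebra_simps(4))

lemma rcos_eq_zero: "x \<in> I \<Longrightarrow> I +> x = \<zero>\<^bsub>quot_algebra A I\<^esub>"
  by (simp add: quot_algebra_simps I.a_rcos_const)

context
  fixes A' :: "('k, 'c) module" and h
  assumes h: "assoc_algebra_hom A A' h"
    and h_zero: "\<And>x. x \<in> I \<Longrightarrow> h x = \<zero>\<^bsub>A'\<^esub>"
begin

interpretation h: assoc_algebra_hom A A' h by (rule h)

text \<open>Vanishing on \<open>I\<close> makes \<open>h\<close> constant on each coset. The image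
  of a coset is then a singleton, from which \<open>the_elem\<close> takes the expected
  value.\<close>

lemma quot_lift_rcos: "x \<in> carrier A \<Longrightarrow> quot_lift h (I +> x) = h x"
proof -
  assume x: "x \<in> carrier A"
  have "h y = h x" if "y \<in> I +> x" for y
    using that x by (auto simp: a_r_coset_def' h.hom_add h_zero I.a_Hcarr)
  then have "h ` (I +> x) = {h x}"
    using I.a_rcos_self[OF x] by blast
  then show ?thesis by (simp add: quot_lift_def)
qed

lemma quot_lift_hom: "assoc_algebra_hom (quot_algebra A I) A' (quot_lift h)"
proof (intro assoc_algebra_hom.intro assoc_algebra_hom_axioms.intro assoc_algebra_quot ring_hom_memI
    h.B.assoc_algebra_axioms)
  fix X assume "X \<in> carrier (quot_algebra A I)"
  then obtain x where x: "x \<in> carrier A" "X = I +> x" by (rule rcosets_cases)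
  then show "quot_lift h X \<in> carrier A'" "\<And>c. quot_lift h (c \<odot>\<^bsub>quot_algebra A I\<^esub> X) = c \<odot>\<^bsub>A'\<^esub> quot_lift h X"
    by (simp_all add: quot_lift_rcos rcos_smult h.hom_smult)
  fix Y assume "Y \<in> carrier (quot_algebra A I)"
  then obtain y where "y \<in> carrier A" "Y = I +> y" by (rule rcosets_cases)
  with x show "quot_lift h (X \<otimes>\<^bsub>quot_algebra A I\<^esub> Y) = quot_lift h X \<otimes>\<^bsub>A'\<^esub> quot_lift h Y"
    and "quot_lift h (X \<oplus>\<^bsub>quot_algebra A I\<^esub> Y) = quot_lift h X \<oplus>\<^bsub>A'\<^esub> quot_lift h Y"
    by (simp_all add: quot_lift_rcos rcos_ops h.hom_mult h.hom_add)
next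
  show "quot_lift h \<one>\<^bsub>quot_algebra A I\<^esub> = \<one>\<^bsub>A'\<^esub>"
    by (simp add: quot_algebra_simps(4) quot_lift_rcos h.hom_one)
qed

end

end

end


section \<open>Tensor products of algebras\<close>

text \<open>The generating set of \<open>alg_tensor_ideal\<close>, named so that closure of the
  relations and the vanishing of maps on them can be treated apart from the ideal.\<close>

definition alg_tensor_rels ::
  "('k::field, 'a) module \<Rightarrow> ('k, 'b) module \<Rightarrow> ('a \<times> 'b \<Rightarrow>\<^sub>0 'k) set" where
  "alg_tensor_rels A B =
      ({Poly_Mapping.single (a \<oplus>\<^bsub>A\<^esub> a', b) 1 - Poly_Mapping.single (a, b) 1
          - Poly_Mapping.single (a', b) 1
          | a a' b. a \<in> carrier A \<and> a' \<in> carrier A \<and> b \<in> carrier B} \<union>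
       {Poly_Mapping.single (a, b \<oplus>\<^bsub>B\<^esub> b') 1 - Poly_Mapping.single (a, b) 1
          - Poly_Mapping.single (a, b') 1
          | a b b'. a \<in> carrier A \<and> b \<in> carrier B \<and> b' \<in> carrier B} \<union>
       {Poly_Mapping.single (c \<odot>\<^bsub>A\<^esub> a, b) 1 - Poly_Mapping.single (a, b) c
          | c a b. a \<in> carrier A \<and> b \<in> carrier B} \<union>
       {Poly_Mapping.single (a, c \<odot>\<^bsub>B\<^esub> b) 1 - Poly_Mapping.single (a, b) c
          | c a b. a \<in> carrier A \<and> b \<in> carrier B})"

lemma alg_tensor_ideal_eq:
  "alg_tensor_ideal A B = genideal (monoid_algebra (A \<times>\<times> B)) (alg_tensor_rels A B)"
  by (simp add: alg_tensor_ideal_def alg_tensor_rels_def)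

lemma keys_minus_subset: "Poly_Mapping.keys f \<subseteq> C \<Longrightarrow> Poly_Mapping.keys g \<subseteq> C \<Longrightarrow> Poly_Mapping.keys (f - g) \<subseteq> C"
  for f g :: "'m \<Rightarrow>\<^sub>0 'k::ab_group_add"
  by (simp add: in_keys_iff lookup_minus subset_iff) metis

lemma monoid_algebra_minus:
  fixes f g :: "'m \<Rightarrow>\<^sub>0 'k::field"
  assumes "monoid M" "Poly_Mapping.keys f \<subseteq> carrier M" "Poly_Mapping.keys g \<subseteq> carrier M"
  shows "f - g = f \<ominus>\<^bsub>monoid_algebra M\<^esub> g"
proof -
  interpret assoc_algebra "monoid_algebra M :: ('k, 'm \<Rightarrow>\<^sub>0 'k) module"
    by (rule assoc_algebra_monoid_algebra) fact
  have c: "f \<in> carrier (monoid_algebra M)" "g \<in> carrier (monoid_algebra M)" "f - g \<in> carrier (monoid_algebra M)"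
    using assms by (simp_all add: monoid_algebra_simps keys_minus_subset)
  have "(f - g) \<oplus>\<^bsub>monoid_algebra M\<^esub> g = f" by (simp add: monoid_algebra_simps)
  then have "(f - g) \<oplus>\<^bsub>monoid_algebra M\<^esub> g \<ominus>\<^bsub>monoid_algebra M\<^esub> g = f \<ominus>\<^bsub>monoid_algebra M\<^esub> g" by simp
  then show ?thesis using c by (simp add: minus_eq a_assoc r_neg)
qed

locale tensor_pair = A: assoc_algebra A + B: assoc_algebra B
  for A :: "('k::field, 'a) module" and B :: "('k, 'b) module"
begin

abbreviation "T \<equiv> alg_tensor A B"
abbreviation "MA \<equiv> monoid_algebra (A \<times>\<times> B) :: ('k, _) module"

lemma monoid_prod: "monoid (A \<times>\<times> B)"
  by (intro DirProd_monoid A.monoid_axioms B.monoid_axioms)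

sublocale MA: assoc_algebra MA
  by (intro assoc_algebra_monoid_algebra monoid_prod)

lemma single_closed: "a \<in> carrier A \<Longrightarrow> b \<in> carrier B \<Longrightarrow> Poly_Mapping.single (a, b) c \<in> carrier MA"
  by (simp add: monoid_algebra_simps)

lemma single_minus:
  assumes "a \<in> carrier A" "b \<in> carrier B" "f \<in> carrier MA"
  shows "f - Poly_Mapping.single (a, b) c = f \<ominus>\<^bsub>MA\<^esub> Poly_Mapping.single (a, b) c"
  using assms by (intro monoid_algebra_minus monoid_prod) (simp_all add: monoid_algebra_simps)

lemma rels_eq: "alg_tensor_rels A B =
      ({Poly_Mapping.single (a \<oplus>\<^bsub>A\<^esub> a', b) 1 \<ominus>\<^bsub>MA\<^esub> Poly_Mapping.single (a, b) 1
          \<ominus>\<^bsub>MA\<^esub> Poly_Mapping.single (a', b) 1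
          | a a' b. a \<in> carrier A \<and> a' \<in> carrier A \<and> b \<in> carrier B} \<union>
       {Poly_Mapping.single (a, b \<oplus>\<^bsub>B\<^esub> b') 1 \<ominus>\<^bsub>MA\<^esub> Poly_Mapping.single (a, b) 1
          \<ominus>\<^bsub>MA\<^esub> Poly_Mapping.single (a, b') 1
          | a b b'. a \<in> carrier A \<and> b \<in> carrier B \<and> b' \<in> carrier B} \<union>
       {Poly_Mapping.single (c \<odot>\<^bsub>A\<^esub> a, b) 1 \<ominus>\<^bsub>MA\<^esub> Poly_Mapping.single (a, b) c
          | c a b. a \<in> carrier A \<and> b \<in> carrier B} \<union>
       {Poly_Mapping.single (a, c \<odot>\<^bsub>B\<^esub> b) 1 \<ominus>\<^bsub>MA\<^esub> Poly_Mapping.single (a, b) c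
          | c a b. a \<in> carrier A \<and> b \<in> carrier B})"
  unfolding alg_tensor_rels_def
  by (intro arg_cong2[of _ _ _ _ "(\<union>)"] Collect_cong ex_cong1)
    (auto simp: single_minus single_closed)

lemma rels_closed: "alg_tensor_rels A B \<subseteq> carrier MA"
  unfolding rels_eq by (auto intro!: MA.minus_closed single_closed)

lemma ideal: "ideal (alg_tensor_ideal A B) MA"
  unfolding alg_tensor_ideal_eq by (rule MA.genideal_ideal[OF rels_closed])

sublocale T: assoc_algebra T
  unfolding alg_tensor_def by (rule MA.assoc_algebra_quot[OF ideal])

sublocale proj: assoc_algebra_hom MA T "\<lambda>x. alg_tensor_ideal A B +>\<^bsub>MA\<^esub> x"
  unfolding alg_tensor_def by (rule MA.rcos_hom[OF ideal])

abbreviation "t \<equiv> pure_tensor A B"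

lemma t_closed [simp]: "a \<in> carrier A \<Longrightarrow> b \<in> carrier B \<Longrightarrow> t a b \<in> carrier T"
  unfolding pure_tensor_def by (intro proj.hom_closed single_closed)

lemma t_single:
  assumes "a \<in> carrier A" "b \<in> carrier B"
  shows "alg_tensor_ideal A B +>\<^bsub>MA\<^esub> Poly_Mapping.single (a, b) c = c \<odot>\<^bsub>T\<^esub> t a b"
proof -
  have "Poly_Mapping.single (a, b) c = c \<odot>\<^bsub>MA\<^esub> Poly_Mapping.single (a, b) 1"
    by (simp add: monoid_algebra_simps)
  then show ?thesis
    using assms by (simp add: pure_tensor_def proj.hom_smult single_closed)
qed

lemma rel_zero:
  assumes "x \<in> alg_tensor_rels A B"
  shows "alg_tensor_ideal A B +>\<^bsub>MA\<^esub> x = \<zero>\<^bsub>T\<^esub>"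
  unfolding alg_tensor_def
  by (rule MA.rcos_eq_zero[OF ideal])
    (use MA.genideal_self[OF rels_closed] assms in \<open>auto simp: alg_tensor_ideal_eq\<close>)

lemma t_add_left:
  assumes "a \<in> carrier A" "a' \<in> carrier A" "b \<in> carrier B"
  shows "t (a \<oplus>\<^bsub>A\<^esub> a') b = t a b \<oplus>\<^bsub>T\<^esub> t a' b"
proof -
  have "Poly_Mapping.single (a \<oplus>\<^bsub>A\<^esub> a', b) 1 \<ominus>\<^bsub>MA\<^esub> Poly_Mapping.single (a, b) 1
          \<ominus>\<^bsub>MA\<^esub> Poly_Mapping.single (a', b) 1 \<in> alg_tensor_rels A B"
    unfolding rels_eq using assms by blast
  from rel_zero[OF this] have "t (a \<oplus>\<^bsub>A\<^esub> a') b \<ominus>\<^bsub>T\<^esub> t a b \<ominus>\<^bsub>T\<^esub> t a' b = \<zero>\<^bsub>T\<^esub>"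
    using assms by (simp add: proj.hom_minus single_closed t_single)
  then show ?thesis
    using assms by (simp add: T.minus_eq_iff T.a_comm)
qed

lemma t_add_right:
  assumes "a \<in> carrier A" "b \<in> carrier B" "b' \<in> carrier B"
  shows "t a (b \<oplus>\<^bsub>B\<^esub> b') = t a b \<oplus>\<^bsub>T\<^esub> t a b'"
proof -
  have "Poly_Mapping.single (a, b \<oplus>\<^bsub>B\<^esub> b') 1 \<ominus>\<^bsub>MA\<^esub> Poly_Mapping.single (a, b) 1
          \<ominus>\<^bsub>MA\<^esub> Poly_Mapping.single (a, b') 1 \<in> alg_tensor_rels A B"
    unfolding rels_eq using assms by blast
  from rel_zero[OF this] have "t a (b \<oplus>\<^bsub>B\<^esub> b') \<ominus>\<^bsub>T\<^esub> t a b \<ominus>\<^bsub>T\<^esub> t a b' = \<zero>\<^bsub>T\<^esub>"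
    using assms by (simp add: proj.hom_minus single_closed t_single)
  then show ?thesis
    using assms by (simp add: T.minus_eq_iff T.a_comm)
qed

lemma t_smult_left:
  assumes "a \<in> carrier A" "b \<in> carrier B"
  shows "t (c \<odot>\<^bsub>A\<^esub> a) b = c \<odot>\<^bsub>T\<^esub> t a b"
proof -
  have "Poly_Mapping.single (c \<odot>\<^bsub>A\<^esub> a, b) 1 \<ominus>\<^bsub>MA\<^esub> Poly_Mapping.single (a, b) c \<in> alg_tensor_rels A B"
    unfolding rels_eq using assms by blast
  from rel_zero[OF this] have "t (c \<odot>\<^bsub>A\<^esub> a) b \<ominus>\<^bsub>T\<^esub> c \<odot>\<^bsub>T\<^esub> t a b = \<zero>\<^bsub>T\<^esub>"
    using assms by (simp add: proj.hom_minus single_closed t_single)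
  then show ?thesis
    using assms by (simp add: T.minus_eq_iff)
qed

lemma t_smult_right:
  assumes "a \<in> carrier A" "b \<in> carrier B"
  shows "t a (c \<odot>\<^bsub>B\<^esub> b) = c \<odot>\<^bsub>T\<^esub> t a b"
proof -
  have "Poly_Mapping.single (a, c \<odot>\<^bsub>B\<^esub> b) 1 \<ominus>\<^bsub>MA\<^esub> Poly_Mapping.single (a, b) c \<in> alg_tensor_rels A B"
    unfolding rels_eq using assms by blast
  from rel_zero[OF this] have "t a (c \<odot>\<^bsub>B\<^esub> b) \<ominus>\<^bsub>T\<^esub> c \<odot>\<^bsub>T\<^esub> t a b = \<zero>\<^bsub>T\<^esub>"
    using assms by (simp add: proj.hom_minus single_closed t_single)
  then show ?thesis
    using assms by (simp add: T.minus_eq_iff)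
qed

lemma t_mult:
  assumes "a \<in> carrier A" "b \<in> carrier B" "a' \<in> carrier A" "b' \<in> carrier B"
  shows "t a b \<otimes>\<^bsub>T\<^esub> t a' b' = t (a \<otimes>\<^bsub>A\<^esub> a') (b \<otimes>\<^bsub>B\<^esub> b')"
  using assms by (simp add: pure_tensor_def single_closed monoid_algebra_mult_single flip: proj.hom_mult)

lemma t_one: "t \<one>\<^bsub>A\<^esub> \<one>\<^bsub>B\<^esub> = \<one>\<^bsub>T\<^esub>"
  using proj.hom_one by (simp add: pure_tensor_def monoid_algebra_simps)

end

locale tensor_hom_pair = tensor_pair A B + T': tensor_pair A' B' +
    f: assoc_algebra_hom A A' f + g: assoc_algebra_hom B B' g
  for A :: "('k::field, 'a) module" and B :: "('k, 'b) module"
    and A' :: "('k, 'c) module" and B' :: "('k, 'd) module" and f g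
begin

text \<open>The map that sends (a, b) to \<open>T'.t (f a) (g b)\<close> is multiplicative on the
  product monoid, hence extends to \<open>MA\<close>. Bilinearity of the tensor in the target makes
  the extension vanish on the relations.\<close>

lemma
  shows alg_tensor_map_hom: "assoc_algebra_hom T T'.T (alg_tensor_map A' B' f g)"
    and alg_tensor_map_t: "a \<in> carrier A \<Longrightarrow> b \<in> carrier B \<Longrightarrow> alg_tensor_map A' B' f g (t a b) = T'.t (f a) (g b)"
proof -
  let ?\<phi> = "\<lambda>(a, b). T'.t (f a) (g b)"
  let ?h = "lin_ext T'.T ?\<phi>"
  have \<phi>: "?\<phi> \<in> carrier (A \<times>\<times> B) \<rightarrow> carrier T'.T" by auto
  interpret h: assoc_algebra_hom MA T'.T ?h
    by (intro lin_ext_hom monoid_prod T'.T.assoc_algebra_axioms)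
      (auto simp: T'.t_mult f.hom_mult g.hom_mult f.hom_one g.hom_one T'.t_one)
  have h_single: "?h (Poly_Mapping.single (a, b) c) = c \<odot>\<^bsub>T'.T\<^esub> T'.t (f a) (g b)"
    if "a \<in> carrier A" "b \<in> carrier B" for a b c
    using lin_ext_single[OF T'.T.assoc_algebra_axioms \<phi>, of "(a, b)"] that by simp
  have minus3: "x \<oplus>\<^bsub>T'.T\<^esub> y \<ominus>\<^bsub>T'.T\<^esub> x \<ominus>\<^bsub>T'.T\<^esub> y = \<zero>\<^bsub>T'.T\<^esub>"
    if "x \<in> carrier T'.T" "y \<in> carrier T'.T" for x y
    using that by (simp add: T'.T.minus_eq_iff T'.T.a_comm)
  have "?h x = \<zero>\<^bsub>T'.T\<^esub>" if "x \<in> alg_tensor_rels A B" for x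
    using that unfolding rels_eq
    by (auto simp: h.hom_minus single_closed h_single f.hom_add g.hom_add f.hom_smult g.hom_smult
        T'.t_add_left T'.t_add_right T'.t_smult_left T'.t_smult_right minus3)
  then have zero: "?h x = \<zero>\<^bsub>T'.T\<^esub>" if "x \<in> alg_tensor_ideal A B" for x
    using h.hom_genideal[OF rels_closed] that by (auto simp: alg_tensor_ideal_eq)
  show "assoc_algebra_hom T T'.T (alg_tensor_map A' B' f g)"
    unfolding alg_tensor_map_def alg_tensor_def[of A B]
    by (rule MA.quot_lift_hom[OF ideal h.assoc_algebra_hom_axioms zero])
  show "alg_tensor_map A' B' f g (t a b) = T'.t (f a) (g b)" if "a \<in> carrier A" "b \<in> carrier B"
    unfolding alg_tensor_map_def pure_tensor_def[of A B]
    using that by (subst MA.quot_lift_rcos[OF ideal h.assoc_algebra_hom_axioms zero]) (simp_all add: single_closed h_single)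
qed

end

lemma (in tensor_pair) t_minus_left:
  assumes "a \<in> carrier A" "a' \<in> carrier A" "b \<in> carrier B"
  shows "t (a \<ominus>\<^bsub>A\<^esub> a') b = t a b \<ominus>\<^bsub>T\<^esub> t a' b"
  using assms t_smult_left[of a' b "-1"]
  by (simp add: A.minus_eq T.minus_eq t_add_left A.smult_uminus T.smult_uminus)

lemma (in tensor_pair) t_minus_right:
  assumes "a \<in> carrier A" "b \<in> carrier B" "b' \<in> carrier B"
  shows "t a (b \<ominus>\<^bsub>B\<^esub> b') = t a b \<ominus>\<^bsub>T\<^esub> t a b'"
  using assms t_smult_right[of a b' "-1"]
  by (simp add: B.minus_eq T.minus_eq t_add_right B.smult_uminus T.smult_uminus)

lemma (in tensor_pair) t_finsum_left:
  assumes "f \<in> S \<rightarrow> carrier A" "b \<in> carrier B"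
  shows "t (\<Oplus>\<^bsub>A\<^esub>i\<in>S. f i) b = (\<Oplus>\<^bsub>T\<^esub>i\<in>S. t (f i) b)"
  using assms(1)
proof (induction S rule: infinite_finite_induct)
  case (insert x F)
  then have "f \<in> F \<rightarrow> carrier A" "f x \<in> carrier A" by auto
  with insert assms(2) show ?case by (simp add: t_add_left Pi_def)
qed (use assms(2) t_smult_left[of "\<zero>\<^bsub>A\<^esub>" b 0] in auto)

lemma (in tensor_pair) t_finsum_right:
  assumes "f \<in> S \<rightarrow> carrier B" "a \<in> carrier A"
  shows "t a (\<Oplus>\<^bsub>B\<^esub>i\<in>S. f i) = (\<Oplus>\<^bsub>T\<^esub>i\<in>S. t a (f i))"
  using assms(1)
proof (induction S rule: infinite_finite_induct)
  case (insert x F)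
  then have "f \<in> F \<rightarrow> carrier B" "f x \<in> carrier B" by auto
  with insert assms(2) show ?case by (simp add: t_add_right Pi_def)
qed (use assms(2) t_smult_right[of a "\<zero>\<^bsub>B\<^esub>" 0] in auto)


section \<open>Tensor, enveloping and Weyl algebras\<close>

text \<open>Closure is all that the tensor algebra relations involve. In this form
  \<open>double_space\<close> with \<open>double_scale\<close> fits without a separate vector space
  structure on pairs of a vector and a functional.\<close>

locale closed_subset =
  fixes scale :: "'k::field \<Rightarrow> 'v::ab_group_add \<Rightarrow> 'v" and V :: "'v set"
  assumes add_closed: "x \<in> V \<Longrightarrow> y \<in> V \<Longrightarrow> x + y \<in> V"
    and scale_closed: "x \<in> V \<Longrightarrow> scale c x \<in> V"

locale linear_into = closed_subset scale V + A: assoc_algebra A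
  for scale :: "'k::field \<Rightarrow> 'v::ab_group_add \<Rightarrow> 'v" and V and A :: "('k, 'a) module" and f +
  assumes closed [simp]: "x \<in> V \<Longrightarrow> f x \<in> carrier A"
    and add: "x \<in> V \<Longrightarrow> y \<in> V \<Longrightarrow> f (x + y) = f x \<oplus>\<^bsub>A\<^esub> f y"
    and smult: "x \<in> V \<Longrightarrow> f (scale c x) = c \<odot>\<^bsub>A\<^esub> f x"

lemma word_monoid: "monoid (word_monoid V)"
  by (rule monoidI) (auto simp: word_monoid_def)

lemma word_monoid_simps [simp]:
  "carrier (word_monoid V) = lists V" "\<one>\<^bsub>word_monoid V\<^esub> = []" "xs \<otimes>\<^bsub>word_monoid V\<^esub> ys = xs @ ys"
  by (simp_all add: word_monoid_def)

context closed_subset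
begin

abbreviation "F \<equiv> monoid_algebra (word_monoid V) :: ('k, 'v list \<Rightarrow>\<^sub>0 'k) module"

sublocale F: assoc_algebra F
  by (intro assoc_algebra_monoid_algebra word_monoid)

lemma word_closed: "x \<in> V \<Longrightarrow> Poly_Mapping.single [x] c \<in> carrier F"
  by (simp add: monoid_algebra_simps)

lemma word_minus:
  "x \<in> V \<Longrightarrow> f \<in> carrier F \<Longrightarrow> f - Poly_Mapping.single [x] c = f \<ominus>\<^bsub>F\<^esub> Poly_Mapping.single [x] c"
  by (intro monoid_algebra_minus word_monoid) (simp_all add: monoid_algebra_simps)

definition tensor_rels :: "('v list \<Rightarrow>\<^sub>0 'k) set" where
  "tensor_rels =
      {Poly_Mapping.single [x + y] 1 \<ominus>\<^bsub>F\<^esub> Poly_Mapping.single [x] 1 \<ominus>\<^bsub>F\<^esub> Poly_Mapping.single [y] 1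
          | x y. x \<in> V \<and> y \<in> V} \<union>
      {Poly_Mapping.single [scale c x] 1 \<ominus>\<^bsub>F\<^esub> Poly_Mapping.single [x] c | c x. x \<in> V}"

lemma tensor_ideal_eq: "tensor_ideal scale V = genideal F tensor_rels"
proof -
  have "tensor_rels =
      ({Poly_Mapping.single [x + y] 1 - Poly_Mapping.single [x] 1 - Poly_Mapping.single [y] 1
          | x y. x \<in> V \<and> y \<in> V} \<union>
       {Poly_Mapping.single [scale c x] 1 - Poly_Mapping.single [x] c | c x. x \<in> V})"
    unfolding tensor_rels_def
    by (intro arg_cong2[of _ _ _ _ "(\<union>)"] Collect_cong ex_cong1)
      (auto simp: word_minus word_closed add_closed scale_closed)
  then show ?thesis by (simp only: tensor_ideal_def)
qed

lemma tensor_rels_closed: "tensor_rels \<subseteq> carrier F"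
  unfolding tensor_rels_def by (auto intro!: F.minus_closed word_closed add_closed scale_closed)

lemma tensor_ideal: "ideal (tensor_ideal scale V) F"
  unfolding tensor_ideal_eq by (rule F.genideal_ideal[OF tensor_rels_closed])

abbreviation "T \<equiv> tensor_algebra scale V"
abbreviation "gen \<equiv> tensor_gen scale V"

sublocale T: assoc_algebra T
  unfolding tensor_algebra_def by (rule F.assoc_algebra_quot[OF tensor_ideal])

sublocale proj: assoc_algebra_hom F T "\<lambda>x. tensor_ideal scale V +>\<^bsub>F\<^esub> x"
  unfolding tensor_algebra_def by (rule F.rcos_hom[OF tensor_ideal])

lemma gen_closed [simp]: "x \<in> V \<Longrightarrow> gen x \<in> carrier T"
  unfolding tensor_gen_def by (intro proj.hom_closed word_closed)

lemma gen_single: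
  assumes "x \<in> V"
  shows "tensor_ideal scale V +>\<^bsub>F\<^esub> Poly_Mapping.single [x] c = c \<odot>\<^bsub>T\<^esub> gen x"
proof -
  have "Poly_Mapping.single [x] c = c \<odot>\<^bsub>F\<^esub> Poly_Mapping.single [x] 1"
    by (simp add: monoid_algebra_simps)
  then show ?thesis
    using assms by (simp add: tensor_gen_def proj.hom_smult word_closed)
qed

lemma tensor_rel_zero: "x \<in> tensor_rels \<Longrightarrow> tensor_ideal scale V +>\<^bsub>F\<^esub> x = \<zero>\<^bsub>T\<^esub>"
  unfolding tensor_algebra_def
  by (rule F.rcos_eq_zero[OF tensor_ideal])
    (use F.genideal_self[OF tensor_rels_closed] in \<open>auto simp: tensor_ideal_eq\<close>)

lemma linear_gen: "linear_into scale V T gen"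
proof
  fix x y c assume xy: "x \<in> V" "y \<in> V"
  have "Poly_Mapping.single [x + y] 1 \<ominus>\<^bsub>F\<^esub> Poly_Mapping.single [x] 1 \<ominus>\<^bsub>F\<^esub> Poly_Mapping.single [y] 1 \<in> tensor_rels"
    unfolding tensor_rels_def using xy by blast
  from tensor_rel_zero[OF this] show "gen (x + y) = gen x \<oplus>\<^bsub>T\<^esub> gen y"
    using xy by (simp add: proj.hom_minus word_closed gen_single add_closed T.minus_eq_iff T.a_comm)
next
  fix x c assume x: "x \<in> V"
  have "Poly_Mapping.single [scale c x] 1 \<ominus>\<^bsub>F\<^esub> Poly_Mapping.single [x] c \<in> tensor_rels"
    unfolding tensor_rels_def using x by blast
  from tensor_rel_zero[OF this] show "gen (scale c x) = c \<odot>\<^bsub>T\<^esub> gen x"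
    using x by (simp add: proj.hom_minus word_closed gen_single scale_closed T.minus_eq_iff)
qed simp

text \<open>Shared by the enveloping and the Weyl algebra, which divide the tensor algebra by
  different ideals.\<close>

lemma linear_into_quot_gen:
  assumes "ideal I T"
  shows "linear_into scale V (quot_algebra T I) (\<lambda>x. I +>\<^bsub>T\<^esub> gen x)"
proof -
  interpret g: linear_into scale V T gen by (rule linear_gen)
  interpret p: assoc_algebra_hom T "quot_algebra T I" "\<lambda>x. I +>\<^bsub>T\<^esub> x" by (rule T.rcos_hom[OF assms])
  show ?thesis
    by (intro linear_into.intro linear_into_axioms.intro closed_subset_axioms p.B.assoc_algebra_axioms)
      (simp_all add: g.add g.smult p.hom_add p.hom_smult)
qed

end

text \<open>The inner of the two nested \<open>quot_lift\<close>s in \<open>env_lift\<close>, named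
  so that the two descents can be justified one at a time.\<close>

definition (in linear_into) tensor_lift where
  "tensor_lift = quot_lift (lin_ext A (\<lambda>xs. foldr (\<lambda>x a. f x \<otimes>\<^bsub>A\<^esub> a) xs \<one>\<^bsub>A\<^esub>))"

text \<open>Universal property of the tensor algebra: the product along a word turns concatenation
  into multiplication, and linearity of \<open>f\<close> kills the relations.\<close>

lemma (in linear_into)
  shows tensor_lift_hom: "assoc_algebra_hom T A tensor_lift"
    and tensor_lift_gen: "x \<in> V \<Longrightarrow> tensor_lift (gen x) = f x"
proof -
  let ?\<phi> = "\<lambda>xs. foldr (\<lambda>x a. f x \<otimes>\<^bsub>A\<^esub> a) xs \<one>\<^bsub>A\<^esub>"
  let ?h = "lin_ext A ?\<phi>"
  have \<phi>_closed: "?\<phi> xs \<in> carrier A" if "xs \<in> lists V" for xs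
    using that by (induction xs) auto
  then have \<phi>: "?\<phi> \<in> carrier (word_monoid V) \<rightarrow> carrier A" by auto
  have \<phi>_mult: "?\<phi> (xs @ ys) = ?\<phi> xs \<otimes>\<^bsub>A\<^esub> ?\<phi> ys" if "xs \<in> lists V" "ys \<in> lists V" for xs ys
    using that
  proof (induction xs)
    case Nil
    then show ?case using \<phi>_closed[of ys] by simp
  next
    case (Cons x xs)
    then show ?case using \<phi>_closed[of ys] \<phi>_closed[of xs] by (simp add: A.m_assoc)
  qed
  interpret h: assoc_algebra_hom F A ?h
    by (intro lin_ext_hom word_monoid A.assoc_algebra_axioms \<phi>) (simp_all only: word_monoid_simps \<phi>_mult foldr.simps id_apply)
  have h_single: "?h (Poly_Mapping.single [x] c) = c \<odot>\<^bsub>A\<^esub> f x" if "x \<in> V" for x c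
    using lin_ext_single[OF A.assoc_algebra_axioms \<phi>, of "[x]"] that by simp
  have minus3: "x \<oplus>\<^bsub>A\<^esub> y \<ominus>\<^bsub>A\<^esub> x \<ominus>\<^bsub>A\<^esub> y = \<zero>\<^bsub>A\<^esub>"
    if "x \<in> carrier A" "y \<in> carrier A" for x y
    using that by (simp add: A.minus_eq_iff A.a_comm)
  have "?h x = \<zero>\<^bsub>A\<^esub>" if "x \<in> tensor_rels" for x
    using that unfolding tensor_rels_def
    by (auto simp: h.hom_minus word_closed h_single add_closed scale_closed add smult minus3)
  then have zero: "?h x = \<zero>\<^bsub>A\<^esub>" if "x \<in> tensor_ideal scale V" for x
    using h.hom_genideal[OF tensor_rels_closed] that by (auto simp: tensor_ideal_eq)
  show "assoc_algebra_hom T A tensor_lift"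
    unfolding tensor_lift_def tensor_algebra_def
    by (rule F.quot_lift_hom[OF tensor_ideal h.assoc_algebra_hom_axioms zero])
  show "tensor_lift (gen x) = f x" if "x \<in> V"
    unfolding tensor_lift_def tensor_gen_def
    using that by (subst F.quot_lift_rcos[OF tensor_ideal h.assoc_algebra_hom_axioms zero]) (simp_all add: word_closed h_single)
qed

section \<open>Universal enveloping algebras and their universal property\<close>

locale lie_subset = closed_subset scale L
  for scale :: "'k::field \<Rightarrow> 'g::ab_group_add \<Rightarrow> 'g" and bracket :: "'g \<Rightarrow> 'g \<Rightarrow> 'g" and L +
  assumes bracket_closed: "x \<in> L \<Longrightarrow> y \<in> L \<Longrightarrow> bracket x y \<in> L"
begin

abbreviation "U \<equiv> env_algebra scale bracket L"
abbreviation "ugen \<equiv> env_gen scale bracket L"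

definition env_rels where
  "env_rels = {commutator T (gen x) (gen y) \<ominus>\<^bsub>T\<^esub> gen (bracket x y) | x y. x \<in> L \<and> y \<in> L}"

lemma env_rels_closed: "env_rels \<subseteq> carrier T"
  by (auto simp: env_rels_def commutator_def bracket_closed)

lemma env_ideal_eq: "env_ideal scale bracket L = genideal T env_rels"
  by (simp add: env_rels_def env_ideal_def)

lemma env_ideal: "ideal (env_ideal scale bracket L) T"
  unfolding env_ideal_eq by (rule T.genideal_ideal[OF env_rels_closed])

sublocale U: linear_into scale L U ugen
  unfolding env_algebra_def env_gen_def by (rule linear_into_quot_gen[OF env_ideal])

lemma ugen_bracket:
  assumes "x \<in> L" "y \<in> L"
  shows "ugen x \<otimes>\<^bsub>U\<^esub> ugen y \<ominus>\<^bsub>U\<^esub> ugen y \<otimes>\<^bsub>U\<^esub> ugen x = ugen (bracket x y)"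
proof -
  interpret p: assoc_algebra_hom T U "\<lambda>x. env_ideal scale bracket L +>\<^bsub>T\<^esub> x"
    unfolding env_algebra_def by (rule T.rcos_hom[OF env_ideal])
  have "commutator T (gen x) (gen y) \<ominus>\<^bsub>T\<^esub> gen (bracket x y) \<in> env_ideal scale bracket L"
    using T.genideal_self[OF env_rels_closed] assms by (auto simp: env_ideal_eq env_rels_def)
  from T.rcos_eq_zero[OF env_ideal this, folded env_algebra_def]
  show ?thesis using assms
    by (simp add: commutator_def p.hom_minus p.hom_mult bracket_closed U.A.minus_eq_iff U.A.l_zero flip: env_gen_def)
qed

end

locale lie_hom_into = lie_subset scale bracket L + linear_into scale L A f
  for scale :: "'k::field \<Rightarrow> 'g::ab_group_add \<Rightarrow> 'g" and bracket L and A :: "('k, 'a) module" and f +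
  assumes bracket: "x \<in> L \<Longrightarrow> y \<in> L \<Longrightarrow> f (bracket x y) = f x \<otimes>\<^bsub>A\<^esub> f y \<ominus>\<^bsub>A\<^esub> f y \<otimes>\<^bsub>A\<^esub> f x"
begin

text \<open>The relation for \<open>x\<close> and \<open>y\<close> is sent to the commutator of
  \<open>f x\<close> and \<open>f y\<close> minus the image of the bracket. It vanishes because
  \<open>f\<close> preserves brackets, and this is what the outer \<open>quot_lift\<close>
  needs.\<close>

lemma
  shows env_lift_hom: "assoc_algebra_hom U A (env_lift A f)"
    and env_lift_ugen: "x \<in> L \<Longrightarrow> env_lift A f (ugen x) = f x"
proof -
  have lift: "env_lift A f = quot_lift tensor_lift"
    by (simp add: env_lift_def tensor_lift_def)
  interpret h: assoc_algebra_hom T A tensor_lift by (rule tensor_lift_hom)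
  have "tensor_lift x = \<zero>\<^bsub>A\<^esub>" if "x \<in> env_rels" for x
    using that unfolding env_rels_def
    by (auto simp: commutator_def h.hom_minus h.hom_mult tensor_lift_gen bracket_closed bracket)
  then have zero: "tensor_lift x = \<zero>\<^bsub>A\<^esub>" if "x \<in> env_ideal scale bracket L" for x
    using h.hom_genideal[OF env_rels_closed] that by (auto simp: env_ideal_eq)
  show "assoc_algebra_hom U A (env_lift A f)"
    unfolding lift env_algebra_def
    by (rule T.quot_lift_hom[OF env_ideal h.assoc_algebra_hom_axioms zero])
  show "env_lift A f (ugen x) = f x" if "x \<in> L"
    unfolding lift env_gen_def
    using that by (subst T.quot_lift_rcos[OF env_ideal h.assoc_algebra_hom_axioms zero]) (simp_all add: tensor_lift_gen)
qed

sublocale lift: assoc_algebra_hom U A "env_lift A f"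
  by (rule env_lift_hom)

end

section \<open>Weyl algebras and their commutation relations\<close>

context closed_subset
begin

context
  fixes \<omega> :: "'v \<Rightarrow> 'v \<Rightarrow> 'k"
begin

abbreviation "Wl \<equiv> weyl_algebra scale V \<omega>"
abbreviation "wgen \<equiv> weyl_gen scale V \<omega>"

definition weyl_rels where
  "weyl_rels = {commutator T (gen v) (gen w) \<ominus>\<^bsub>T\<^esub> (\<omega> v w \<odot>\<^bsub>T\<^esub> \<one>\<^bsub>T\<^esub>) | v w. v \<in> V \<and> w \<in> V}"

lemma weyl_rels_closed: "weyl_rels \<subseteq> carrier T"
  by (auto simp: weyl_rels_def commutator_def)

lemma weyl_ideal_eq: "weyl_ideal scale V \<omega> = genideal T weyl_rels"
  by (simp add: weyl_rels_def weyl_ideal_def)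

lemma weyl_ideal: "ideal (weyl_ideal scale V \<omega>) T"
  unfolding weyl_ideal_eq by (rule T.genideal_ideal[OF weyl_rels_closed])

lemma linear_wgen: "linear_into scale V Wl wgen"
  unfolding weyl_algebra_def weyl_gen_def by (rule linear_into_quot_gen[OF weyl_ideal])

lemma wgen_commutator:
  assumes "v \<in> V" "w \<in> V"
  shows "wgen v \<otimes>\<^bsub>Wl\<^esub> wgen w \<ominus>\<^bsub>Wl\<^esub> wgen w \<otimes>\<^bsub>Wl\<^esub> wgen v = \<omega> v w \<odot>\<^bsub>Wl\<^esub> \<one>\<^bsub>Wl\<^esub>"
proof -
  interpret p: assoc_algebra_hom T Wl "\<lambda>x. weyl_ideal scale V \<omega> +>\<^bsub>T\<^esub> x"
    unfolding weyl_algebra_def by (rule T.rcos_hom[OF weyl_ideal])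
  interpret W: linear_into scale V Wl wgen by (rule linear_wgen)
  have "commutator T (gen v) (gen w) \<ominus>\<^bsub>T\<^esub> (\<omega> v w \<odot>\<^bsub>T\<^esub> \<one>\<^bsub>T\<^esub>) \<in> weyl_ideal scale V \<omega>"
    using T.genideal_self[OF weyl_rels_closed] assms by (auto simp: weyl_ideal_eq weyl_rels_def)
  from T.rcos_eq_zero[OF weyl_ideal this, folded weyl_algebra_def]
  show ?thesis using assms
    by (simp add: commutator_def p.hom_minus p.hom_mult p.hom_smult p.hom_one p.B.minus_eq_iff p.B.l_zero flip: weyl_gen_def)
qed

end

end

text \<open>Elements of the two tensor factors commute, so the commutator splits into one commutator
  in each factor. The canonical map into U(k) together with \<open>\<nu>\<close> yields
  \<open>Delta\<close>.\<close>

lemma lie_hom_into_tensor: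
  assumes "lie_hom_into scale bracket L A f" "lie_hom_into scale bracket L B g"
  shows "lie_hom_into scale bracket L (alg_tensor A B)
    (\<lambda>x. pure_tensor A B (f x) \<one>\<^bsub>B\<^esub> \<oplus>\<^bsub>alg_tensor A B\<^esub> pure_tensor A B \<one>\<^bsub>A\<^esub> (g x))"
proof -
  interpret f: lie_hom_into scale bracket L A f by fact
  interpret g: lie_hom_into scale bracket L B g by fact
  interpret tensor_pair A B by unfold_locales
  show ?thesis
  proof (intro lie_hom_into.intro linear_into.intro lie_hom_into_axioms.intro linear_into_axioms.intro
      f.lie_subset_axioms f.closed_subset_axioms T.assoc_algebra_axioms)
    fix x y assume xy: "x \<in> L" "y \<in> L"
    then show "t (f (x + y)) \<one>\<^bsub>B\<^esub> \<oplus>\<^bsub>T\<^esub> t \<one>\<^bsub>A\<^esub> (g (x + y)) =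
      t (f x) \<one>\<^bsub>B\<^esub> \<oplus>\<^bsub>T\<^esub> t \<one>\<^bsub>A\<^esub> (g x) \<oplus>\<^bsub>T\<^esub> (t (f y) \<one>\<^bsub>B\<^esub> \<oplus>\<^bsub>T\<^esub> t \<one>\<^bsub>A\<^esub> (g y))"
      by (simp add: f.add g.add t_add_left t_add_right T.a_ac)
    from xy show "t (f (bracket x y)) \<one>\<^bsub>B\<^esub> \<oplus>\<^bsub>T\<^esub> t \<one>\<^bsub>A\<^esub> (g (bracket x y)) =
       (t (f x) \<one>\<^bsub>B\<^esub> \<oplus>\<^bsub>T\<^esub> t \<one>\<^bsub>A\<^esub> (g x)) \<otimes>\<^bsub>T\<^esub> (t (f y) \<one>\<^bsub>B\<^esub> \<oplus>\<^bsub>T\<^esub> t \<one>\<^bsub>A\<^esub> (g y)) \<ominus>\<^bsub>T\<^esub>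
       (t (f y) \<one>\<^bsub>B\<^esub> \<oplus>\<^bsub>T\<^esub> t \<one>\<^bsub>A\<^esub> (g y)) \<otimes>\<^bsub>T\<^esub> (t (f x) \<one>\<^bsub>B\<^esub> \<oplus>\<^bsub>T\<^esub> t \<one>\<^bsub>A\<^esub> (g x))"
      by (subst T.commutator_add) (simp_all add: t_mult f.bracket g.bracket t_minus_left t_minus_right)
  qed (simp_all add: f.smult g.smult t_smult_left t_smult_right T.smult_r_distr)
qed


section \<open>Dual bases\<close>

lemma (in vector_space) linear_into_zero:
  assumes "linear_into scale V A f" "subspace V"
  shows "f 0 = \<zero>\<^bsub>A\<^esub>"
proof -
  interpret f: linear_into scale V A f by fact
  have "0 \<in> V" using assms(2) by (rule subspace_0)
  then show ?thesis using f.smult[of 0 0] by simp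
qed

lemma (in vector_space) linear_into_sum:
  assumes "linear_into scale V A f" "subspace V" "\<And>i. i \<in> S \<Longrightarrow> u i \<in> V"
  shows "f (\<Sum>i\<in>S. scale (c i) (u i)) = (\<Oplus>\<^bsub>A\<^esub>i\<in>S. c i \<odot>\<^bsub>A\<^esub> f (u i))"
proof -
  interpret f: linear_into scale V A f by fact
  show ?thesis
    using assms(3)
  proof (induction S rule: infinite_finite_induct)
    case (insert x F)
    then have "(\<Sum>i\<in>F. scale (c i) (u i)) \<in> V"
      by (intro subspace_sum assms(2) f.scale_closed) auto
    with insert show ?case
      by (simp add: f.add f.smult f.scale_closed Pi_def)
  qed (simp_all add: linear_into_zero[OF assms(1,2)])
qed

lemma (in vector_space) linear_into_uminus:
  assumes "linear_into scale V A f" "x \<in> V"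
  shows "f (- x) = \<ominus>\<^bsub>A\<^esub> f x"
proof -
  interpret f: linear_into scale V A f by fact
  show ?thesis using f.smult[OF assms(2), of "-1"] assms(2) by (simp add: f.A.smult_uminus)
qed

lemma linear_module_hom: "Vector_Spaces.linear s1 s2 f \<Longrightarrow> module_hom s1 s2 f"
  by (simp add: Vector_Spaces.linear_def)

context quadratic_lie_algebra
begin

lemmas bracket_hom_right = linear_module_hom[OF bracket_linear_right]
lemmas bracket_hom_left = linear_module_hom[OF bracket_linear_left]
lemmas B_hom_left = linear_module_hom[OF B_linear]

lemmas bracket_add_right = module_hom.add[OF bracket_hom_right]
lemmas bracket_add_left = module_hom.add[OF bracket_hom_left]
lemmas bracket_scale_left = module_hom.scale[OF bracket_hom_left]
lemmas bracket_uminus_right = module_hom.neg[OF bracket_hom_right]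

lemma bracket_sum_right: "bracket x (\<Sum>i\<in>S. scale (c i) (u i)) = (\<Sum>i\<in>S. scale (c i) (bracket x (u i)))"
  by (simp add: module_hom.sum[OF bracket_hom_right] module_hom.scale[OF bracket_hom_right])

lemma bracket_skew: "bracket x y = - bracket y x"
proof -
  have "bracket x y + bracket y x = bracket (x + y) (x + y)"
    by (simp only: bracket_add_left bracket_add_right) (simp add: bracket_self)
  then show ?thesis
    by (simp add: bracket_self eq_neg_iff_add_eq_0)
qed

text \<open>The Jacobi identity in the form ad [x, y] = [ad x, ad y], the shape in which it enters
  the proof that \<open>\<nu>\<close> preserves brackets.\<close>

lemma bracket_bracket: "bracket (bracket x y) z = bracket x (bracket y z) - bracket y (bracket x z)"
proof -
  have "bracket (bracket x y) z = - bracket z (bracket x y)" by (rule bracket_skew)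
  moreover have "bracket y (bracket z x) = - bracket y (bracket x z)"
    by (subst bracket_skew[of z x]) (rule bracket_uminus_right)
  moreover have "- bracket z (bracket x y) = bracket x (bracket y z) + bracket y (bracket z x)"
    using jacobi[of x y z] by (simp add: neg_eq_iff_add_eq_0 add.commute)
  ultimately show ?thesis by simp
qed

lemma B_sum_left: "B (\<Sum>i\<in>S. scale (c i) (u i)) y = (\<Sum>i\<in>S. c i * B (u i) y)"
  by (simp add: module_hom.sum[OF B_hom_left] module_hom.scale[OF B_hom_left])

lemma B_sum_right: "B x (\<Sum>i\<in>S. scale (c i) (u i)) = (\<Sum>i\<in>S. c i * B x (u i))"
  by (simp add: B_sym[of x] B_sum_left)

lemma B_diff_right: "B x (y - y') = B x y - B x y'"
  by (simp add: B_sym[of x] module_hom.diff[OF B_hom_left])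

context
  fixes S :: "'g set" and K :: "'i set" and e e' :: "'i \<Rightarrow> 'g"
  assumes S: "subspace S" and basis: "is_basis scale S K e" and dual: "dual_family B S K e e'"
begin

lemma basis_simps:
  "finite K" "i \<in> K \<Longrightarrow> e i \<in> S" "i \<in> K \<Longrightarrow> e' i \<in> S"
  using basis dual span_superset[of "e ` K"] by (auto simp: is_basis_def dual_family_def)

lemma dual_delta: "i \<in> K \<Longrightarrow> j \<in> K \<Longrightarrow> B (e i) (e' j) = (if i = j then 1 else 0)"
  using dual by (simp add: dual_family_def)

text \<open>Pairing any expansion of \<open>x\<close> in \<open>e\<close> with \<open>e' j\<close>
  isolates the coefficient of \<open>e j\<close>.\<close>

lemma basis_expand:
  assumes "x \<in> S"
  shows "(\<Sum>k\<in>K. scale (B x (e' k)) (e k)) = x"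
proof -
  have "x \<in> span (e ` K)" using assms basis by (simp add: is_basis_def)
  then obtain u where "x = (\<Sum>v\<in>e ` K. scale (u v) v)"
    using span_finite[of "e ` K"] basis_simps(1) by auto
  also have "\<dots> = (\<Sum>k\<in>K. scale (u (e k)) (e k))"
    using basis by (intro sum.reindex[unfolded o_def]) (simp add: is_basis_def)
  finally have x: "x = (\<Sum>k\<in>K. scale (u (e k)) (e k))" .
  have "B x (e' j) = u (e j)" if "j \<in> K" for j
  proof -
    have "B x (e' j) = (\<Sum>k\<in>K. u (e k) * B (e k) (e' j))" by (subst x) (rule B_sum_left)
    also have "\<dots> = (\<Sum>k\<in>K. if k = j then u (e k) else 0)"
      using that by (intro sum.cong) (simp_all add: dual_delta)
    finally show ?thesis using that basis_simps(1) by (simp add: sum.delta)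
  qed
  then show ?thesis by (simp add: x[symmetric])
qed

text \<open>That \<open>e'\<close> spans \<open>S\<close> has to be derived. The defect
  \<open>d\<close> pairs to zero with each \<open>e j\<close>, hence with all of \<open>S\<close>,
  and nondegeneracy on \<open>S\<close> makes it vanish.\<close>

lemma dual_expand:
  assumes nondeg: "\<And>d. d \<in> S \<Longrightarrow> (\<And>x. x \<in> S \<Longrightarrow> B x d = 0) \<Longrightarrow> d = 0" and y: "y \<in> S"
  shows "(\<Sum>k\<in>K. scale (B (e k) y) (e' k)) = y"
proof -
  define d where "d = y - (\<Sum>k\<in>K. scale (B (e k) y) (e' k))"
  have d: "d \<in> S"
    unfolding d_def by (intro subspace_diff subspace_sum subspace_scale S y basis_simps)
  have e: "B (e j) d = 0" if "j \<in> K" for j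
  proof -
    have "(\<Sum>k\<in>K. B (e k) y * B (e j) (e' k)) = (\<Sum>k\<in>K. if k = j then B (e k) y else 0)"
      using that by (intro sum.cong) (auto simp add: dual_delta)
    then show ?thesis using that basis_simps(1) by (simp add: d_def B_diff_right B_sum_right sum.delta)
  qed
  have "B x d = 0" if "x \<in> S" for x
    by (subst basis_expand[OF that, symmetric]) (simp add: B_sum_left e)
  then have "d = 0" using d by (intro nondeg)
  then show ?thesis by (simp add: d_def)
qed

end

text \<open>The sums over \<open>e\<close>, \<open>e'\<close> and \<open>h\<close>, \<open>h'\<close> are the canonical tensors of two spaces with a form; an
  operator applied in the first slot of one equals its adjoint applied in the second slot of the other.\<close>

lemma dual_bases_adjoint:
  assumes A: "assoc_algebra A" and sub: "subspace X" "subspace Y" and fin: "finite K" "finite L"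
    and F_left: "\<And>y. y \<in> Y \<Longrightarrow> linear_into scale X A (\<lambda>x. F x y)"
    and F_right: "\<And>x. x \<in> X \<Longrightarrow> linear_into scale Y A (F x)"
    and e': "\<And>k. k \<in> K \<Longrightarrow> e' k \<in> Y" and h: "\<And>l. l \<in> L \<Longrightarrow> h l \<in> X"
    and T: "\<And>k. k \<in> K \<Longrightarrow> T (e k) \<in> X" and T': "\<And>l. l \<in> L \<Longrightarrow> T' (h' l) \<in> Y"
    and adj: "\<And>k l. k \<in> K \<Longrightarrow> l \<in> L \<Longrightarrow> B (T (e k)) (h' l) = B (e k) (T' (h' l))"
    and h_expand: "\<And>x. x \<in> X \<Longrightarrow> (\<Sum>l\<in>L. scale (B x (h' l)) (h l)) = x"
    and e'_expand: "\<And>y. y \<in> Y \<Longrightarrow> (\<Sum>k\<in>K. scale (B (e k) y) (e' k)) = y"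
  shows "(\<Oplus>\<^bsub>A\<^esub>k\<in>K. F (T (e k)) (e' k)) = (\<Oplus>\<^bsub>A\<^esub>l\<in>L. F (h l) (T' (h' l)))"
proof -
  interpret A: assoc_algebra A by (rule A)
  have F: "F x y \<in> carrier A" if "x \<in> X" "y \<in> Y" for x y
    using linear_into.closed[OF F_right[OF that(1)] that(2)] .
  \<comment> \<open>Both sides equal this double sum: expanding \<open>T (e k)\<close> in
    \<open>h\<close> produces it, with \<open>adj\<close> rewriting the coefficients, and collecting
    the \<open>e' k\<close> for fixed \<open>l\<close> gives \<open>T' (h' l)\<close>.\<close>
  have "(\<Oplus>\<^bsub>A\<^esub>k\<in>K. F (T (e k)) (e' k))
      = (\<Oplus>\<^bsub>A\<^esub>k\<in>K. \<Oplus>\<^bsub>A\<^esub>l\<in>L. B (e k) (T' (h' l)) \<odot>\<^bsub>A\<^esub> F (h l) (e' k))"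
  proof (rule A.finsum_cong')
    fix k assume k: "k \<in> K"
    have "F (T (e k)) (e' k) = F (\<Sum>l\<in>L. scale (B (e k) (T' (h' l))) (h l)) (e' k)"
      using h_expand[OF T[OF k]] adj[OF k] by simp
    also have "\<dots> = (\<Oplus>\<^bsub>A\<^esub>l\<in>L. B (e k) (T' (h' l)) \<odot>\<^bsub>A\<^esub> F (h l) (e' k))"
      by (rule linear_into_sum[OF F_left[OF e'[OF k]] sub(1) h])
    finally show "F (T (e k)) (e' k) = (\<Oplus>\<^bsub>A\<^esub>l\<in>L. B (e k) (T' (h' l)) \<odot>\<^bsub>A\<^esub> F (h l) (e' k))" .
  qed (auto intro!: A.finsum_closed F h e')
  also have "\<dots> = (\<Oplus>\<^bsub>A\<^esub>l\<in>L. \<Oplus>\<^bsub>A\<^esub>k\<in>K. B (e k) (T' (h' l)) \<odot>\<^bsub>A\<^esub> F (h l) (e' k))"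
    by (intro A.finsum_swap fin A.smult_closed F h e')
  also have "\<dots> = (\<Oplus>\<^bsub>A\<^esub>l\<in>L. F (h l) (T' (h' l)))"
  proof (rule A.finsum_cong')
    fix l assume l: "l \<in> L"
    show "(\<Oplus>\<^bsub>A\<^esub>k\<in>K. B (e k) (T' (h' l)) \<odot>\<^bsub>A\<^esub> F (h l) (e' k)) = F (h l) (T' (h' l))"
      using linear_into_sum[OF F_right[OF h[OF l]] sub(2) e', of K "\<lambda>k. k" "\<lambda>k. B (e k) (T' (h' l))"]
      by (simp add: e'_expand[OF T'[OF l]])
  qed (auto intro!: F h T')
  finally show ?thesis .
qed

end


section \<open>The symplectic Dirac operators\<close>

locale symplectic_dirac = z2_graded_quadratic_lie_algebra scale bracket B kk pp
  for scale :: "'k::field \<Rightarrow> 'g::ab_group_add \<Rightarrow> 'g" and bracket and B and kk pp +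
  fixes I :: "'i set" and w w' :: "'i \<Rightarrow> 'g"
    and J :: "'j set" and z z' :: "'j \<Rightarrow> 'g" and zs :: "'j \<Rightarrow> 'g \<Rightarrow> 'k"
  assumes w: "is_basis scale kk I w" and w': "dual_family B kk I w w'"
    and z: "is_basis scale pp J z" and z': "dual_family B pp J z z'"
    and zs: "dual_basis scale pp J z zs"
begin

lemmas kk_basis = basis_simps[OF subspace_kk w w']
lemmas pp_basis = basis_simps[OF subspace_pp z z']
declare kk_basis [simp] pp_basis [simp]

lemma bracket_pp_kk: "x \<in> pp \<Longrightarrow> y \<in> kk \<Longrightarrow> bracket x y \<in> pp"
  by (subst bracket_skew) (simp add: bracket_kk_pp subspace_neg subspace_pp)

lemma B_add_right: "B x (y + y') = B x y + B x y'"
  by (simp add: B_sym[of x] module_hom.add[OF B_hom_left])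

text \<open>Orthogonality to \<open>pp\<close> lets only the \<open>kk\<close> component of
  \<open>y\<close> count in \<open>B d y\<close>, so nondegeneracy of \<open>B\<close> on the whole
  algebra restricts to \<open>kk\<close>.\<close>

lemma kk_nondegenerate: "d \<in> kk \<Longrightarrow> (\<And>x. x \<in> kk \<Longrightarrow> B x d = 0) \<Longrightarrow> d = 0"
proof (rule B_nondegenerate)
  fix y assume d: "d \<in> kk" "\<And>x. x \<in> kk \<Longrightarrow> B x d = 0"
  obtain a b where "a \<in> kk" "b \<in> pp" "y = a + b" using kk_plus_pp[of y] by blast
  then show "B d y = 0" using d by (simp add: B_add_right kk_orth_pp B_sym[of d a])
qed

lemma pp_nondegenerate: "d \<in> pp \<Longrightarrow> (\<And>x. x \<in> pp \<Longrightarrow> B x d = 0) \<Longrightarrow> d = 0"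
proof (rule B_nondegenerate)
  fix y assume d: "d \<in> pp" "\<And>x. x \<in> pp \<Longrightarrow> B x d = 0"
  obtain a b where "a \<in> kk" "b \<in> pp" "y = a + b" using kk_plus_pp[of y] by blast
  then show "B d y = 0" using d by (simp add: B_add_right kk_orth_pp B_sym[of d])
qed

lemmas w_expand = basis_expand[OF subspace_kk w w']
lemmas z_expand = basis_expand[OF subspace_pp z z']

lemma w'_expand: "x \<in> kk \<Longrightarrow> (\<Sum>k\<in>I. scale (B (w k) x) (w' k)) = x"
  by (rule dual_expand[OF subspace_kk w w' kk_nondegenerate])

lemma z'_expand: "x \<in> pp \<Longrightarrow> (\<Sum>i\<in>J. scale (B (z i) x) (z' i)) = x"
  by (rule dual_expand[OF subspace_pp z z' pp_nondegenerate])

text \<open>The identification of p* with p through \<open>B\<close>. It turns the scalars of the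
  Weyl relations into coordinates with respect to \<open>z\<close>, ready for
  \<open>z_expand\<close>.\<close>

lemma zs_eq:
  assumes j: "j \<in> J" and x: "x \<in> pp"
  shows "zs j x = B x (z' j)"
proof -
  have zs_j: "zs j \<in> dual_space scale pp" using j zs by (simp add: dual_basis_def)
  have "0 \<in> pp" by (rule subspace_0[OF subspace_pp])
  have zero: "zs j 0 = 0"
    using zs_j \<open>0 \<in> pp\<close> by (simp add: dual_space_def) (metis mult_zero_left scale_zero_left)
  \<comment> \<open>Membership in \<open>pp\<close> is proved together with the value because
    elements of \<open>dual_space\<close> are additive on \<open>pp\<close> only.\<close>
  have "(\<Sum>k\<in>K. scale (c k) (z k)) \<in> pp \<and> zs j (\<Sum>k\<in>K. scale (c k) (z k)) = (\<Sum>k\<in>K. c k * zs j (z k))"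
    if "finite K" "K \<subseteq> J" for K and c :: "'j \<Rightarrow> 'k"
    using that
  proof (induction K rule: finite_induct)
    case empty
    then show ?case using zero \<open>0 \<in> pp\<close> by simp
  next
    case (insert k F)
    then have "scale (c k) (z k) \<in> pp" "z k \<in> pp" by (simp_all add: subspace_scale subspace_pp)
    with insert zs_j show ?case
      by (simp add: dual_space_def subspace_add subspace_pp)
  qed
  from this[of J "\<lambda>k. B x (z' k)"] have "zs j x = (\<Sum>k\<in>J. B x (z' k) * zs j (z k))"
    by (simp add: z_expand x)
  also have "\<dots> = (\<Sum>k\<in>J. if k = j then B x (z' k) else 0)"
    using j zs by (intro sum.cong) (auto simp: dual_basis_def)
  finally show ?thesis using j by (simp add: sum.delta)
qed

section \<open>The enveloping and Weyl algebras of the graded Lie algebra\<close>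

sublocale g: lie_subset scale bracket UNIV
  by unfold_locales simp_all

sublocale k: lie_subset scale bracket kk
  by unfold_locales (simp_all add: subspace_add subspace_scale subspace_kk bracket_kk_kk)

sublocale p: closed_subset scale pp
  by unfold_locales (simp_all add: subspace_add subspace_scale subspace_pp)

lemma zero_dual: "0 \<in> dual_space scale pp"
  by (simp add: dual_space_def)

sublocale d: closed_subset "double_scale scale" "double_space scale pp"
  by unfold_locales
    (auto simp: double_scale_def double_space_def dual_space_def p.add_closed p.scale_closed algebra_simps)

abbreviation "W \<equiv> double_weyl scale pp"
abbreviation "v \<equiv> weyl_vec scale pp"
abbreviation "c j \<equiv> weyl_covec scale pp (zs j)"

sublocale wg: linear_into "double_scale scale" "double_space scale pp" W
    "weyl_gen (double_scale scale) (double_space scale pp) double_form"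
  unfolding double_weyl_def by (rule d.linear_wgen)

sublocale v: linear_into scale pp W v
proof
  fix x y assume xy: "x \<in> pp" "y \<in> pp"
  then have *: "(x, 0) \<in> double_space scale pp" "(y, 0) \<in> double_space scale pp"
    by (simp_all add: double_space_def zero_dual)
  show "v x \<in> carrier W" using * by (simp add: weyl_vec_def)
  show "v (x + y) = v x \<oplus>\<^bsub>W\<^esub> v y"
    using wg.add[OF *] by (simp add: weyl_vec_def)
  have "double_scale scale r (x, 0) = (scale r x, 0)" for r
    by (simp add: double_scale_def zero_fun_def)
  then show "v (scale r x) = r \<odot>\<^bsub>W\<^esub> v x" for r
    using wg.smult[OF *(1), of r] by (simp add: weyl_vec_def)
qed

lemma double_space_gens:
  "x \<in> pp \<Longrightarrow> (x, 0) \<in> double_space scale pp" "j \<in> J \<Longrightarrow> (0, zs j) \<in> double_space scale pp"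
  using zs by (simp_all add: double_space_def zero_dual dual_basis_def subspace_0 subspace_pp)

lemma c_closed [simp]: "j \<in> J \<Longrightarrow> c j \<in> carrier W"
  using double_space_gens(2) by (simp add: weyl_covec_def)

lemma double_form_apply: "double_form (x, \<alpha>) (y, \<beta>) = \<alpha> y - \<beta> x"
  by (simp add: double_form_def)

lemma v_v: "x \<in> pp \<Longrightarrow> y \<in> pp \<Longrightarrow> v x \<otimes>\<^bsub>W\<^esub> v y = v y \<otimes>\<^bsub>W\<^esub> v x"
  using d.wgen_commutator[OF double_space_gens(1) double_space_gens(1), of x y double_form, folded double_weyl_def]
  by (simp add: weyl_vec_def[symmetric] double_form_apply wg.A.minus_eq_iff wg.A.l_zero)

lemma c_c: "i \<in> J \<Longrightarrow> j \<in> J \<Longrightarrow> c i \<otimes>\<^bsub>W\<^esub> c j = c j \<otimes>\<^bsub>W\<^esub> c i"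
proof -
  assume ij: "i \<in> J" "j \<in> J"
  \<comment> \<open>On these two covectors the form takes the value \<open>zs i 0 - zs j 0\<close>.
    The empty sum in \<open>B_sum_left\<close> supplies the zero in the first argument of
    \<open>B\<close>.\<close>
  then have "zs i 0 = 0" "zs j 0 = 0"
    using zs_eq[of _ 0] subspace_0[OF subspace_pp] B_sum_left[of "\<lambda>_. 0" "\<lambda>_. 0" "{}"] by simp_all
  then show ?thesis
    using ij d.wgen_commutator[OF double_space_gens(2) double_space_gens(2), of i j double_form, folded double_weyl_def]
    by (simp add: weyl_covec_def[symmetric] double_form_apply wg.A.minus_eq_iff wg.A.l_zero)
qed

text \<open>The reordering rule for a covector standing left of a vector; \<open>zs_eq\<close> has
  turned its scalar into a coordinate of \<open>x\<close>.\<close>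

lemma c_v: "j \<in> J \<Longrightarrow> x \<in> pp \<Longrightarrow> c j \<otimes>\<^bsub>W\<^esub> v x = v x \<otimes>\<^bsub>W\<^esub> c j \<oplus>\<^bsub>W\<^esub> B x (z' j) \<odot>\<^bsub>W\<^esub> \<one>\<^bsub>W\<^esub>"
  using d.wgen_commutator[OF double_space_gens(2) double_space_gens(1), of j x double_form, folded double_weyl_def]
  by (simp add: weyl_covec_def[symmetric] weyl_vec_def[symmetric] double_form_apply wg.A.minus_eq_iff zs_eq wg.A.a_comm)

section \<open>The Lie morphism from k to the Weyl algebra\<close>

abbreviation "\<nu> \<equiv> nu scale bracket pp J z zs"

lemma \<nu>_closed [simp]: "x \<in> kk \<Longrightarrow> \<nu> x \<in> carrier W"
  by (auto simp: nu_def intro!: wg.A.finsum_closed simp: bracket_kk_pp)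

text \<open>Only moving \<open>v b\<close> past \<open>c i\<close> contributes, with coefficient
  \<open>B b (z' i)\<close>. These are the coordinates of \<open>b\<close>, so linearity of the
  bracket assembles the contributions: \<open>\<nu> x\<close> acts on vectors as ad x.\<close>

lemma \<nu>_v:
  assumes "x \<in> kk" "b \<in> pp"
  shows "\<nu> x \<otimes>\<^bsub>W\<^esub> v b \<ominus>\<^bsub>W\<^esub> v b \<otimes>\<^bsub>W\<^esub> \<nu> x = v (bracket x b)"
proof -
  have [simp]: "bracket x (z i) \<in> pp" if "i \<in> J" for i using that assms by (simp add: bracket_kk_pp)
  have "\<nu> x \<otimes>\<^bsub>W\<^esub> v b \<ominus>\<^bsub>W\<^esub> v b \<otimes>\<^bsub>W\<^esub> \<nu> x =
    (\<Oplus>\<^bsub>W\<^esub>i\<in>J. v (bracket x (z i)) \<otimes>\<^bsub>W\<^esub> c i \<otimes>\<^bsub>W\<^esub> v b \<ominus>\<^bsub>W\<^esub> v b \<otimes>\<^bsub>W\<^esub> (v (bracket x (z i)) \<otimes>\<^bsub>W\<^esub> c i))"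
    unfolding nu_def using assms by (intro wg.A.commutator_finsum_left) auto
  also have "\<dots> = (\<Oplus>\<^bsub>W\<^esub>i\<in>J. B b (z' i) \<odot>\<^bsub>W\<^esub> v (bracket x (z i)))"
  proof (rule wg.A.finsum_cong')
    fix i assume i: "i \<in> J"
    let ?a = "bracket x (z i)"
    have "v ?a \<otimes>\<^bsub>W\<^esub> c i \<otimes>\<^bsub>W\<^esub> v b = v ?a \<otimes>\<^bsub>W\<^esub> (v b \<otimes>\<^bsub>W\<^esub> c i \<oplus>\<^bsub>W\<^esub> B b (z' i) \<odot>\<^bsub>W\<^esub> \<one>\<^bsub>W\<^esub>)"
      using i assms by (simp add: wg.A.m_assoc c_v)
    also have "\<dots> = v ?a \<otimes>\<^bsub>W\<^esub> v b \<otimes>\<^bsub>W\<^esub> c i \<oplus>\<^bsub>W\<^esub> B b (z' i) \<odot>\<^bsub>W\<^esub> v ?a"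
      using i assms by (simp add: wg.A.r_distr wg.A.m_assoc wg.A.smult_mult_right)
    also have "v ?a \<otimes>\<^bsub>W\<^esub> v b = v b \<otimes>\<^bsub>W\<^esub> v ?a"
      using i assms by (simp add: v_v)
    finally show "v ?a \<otimes>\<^bsub>W\<^esub> c i \<otimes>\<^bsub>W\<^esub> v b \<ominus>\<^bsub>W\<^esub> v b \<otimes>\<^bsub>W\<^esub> (v ?a \<otimes>\<^bsub>W\<^esub> c i) = B b (z' i) \<odot>\<^bsub>W\<^esub> v ?a"
      using i assms by (simp add: wg.A.minus_eq_iff wg.A.a_comm wg.A.m_assoc)
  qed (use assms in auto)
  also have "\<dots> = v (\<Sum>i\<in>J. scale (B b (z' i)) (bracket x (z i)))"
    by (rule linear_into_sum[OF v.linear_into_axioms subspace_pp, symmetric]) simp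
  also have "\<dots> = v (bracket x b)"
    by (simp add: z_expand assms flip: bracket_sum_right)
  finally show ?thesis .
qed

text \<open>The contragredient of the action on vectors: the covector passes the vector
  \<open>[x, z\<^sub>i]\<close>, which leaves minus a matrix entry of ad x, with the summation now
  over the other index.\<close>

lemma \<nu>_c:
  assumes "x \<in> kk" "j \<in> J"
  shows "\<nu> x \<otimes>\<^bsub>W\<^esub> c j \<ominus>\<^bsub>W\<^esub> c j \<otimes>\<^bsub>W\<^esub> \<nu> x = \<ominus>\<^bsub>W\<^esub> (\<Oplus>\<^bsub>W\<^esub>i\<in>J. B (bracket x (z i)) (z' j) \<odot>\<^bsub>W\<^esub> c i)"
proof -
  have [simp]: "bracket x (z i) \<in> pp" if "i \<in> J" for i using that assms by (simp add: bracket_kk_pp)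
  have "\<nu> x \<otimes>\<^bsub>W\<^esub> c j \<ominus>\<^bsub>W\<^esub> c j \<otimes>\<^bsub>W\<^esub> \<nu> x =
    (\<Oplus>\<^bsub>W\<^esub>i\<in>J. v (bracket x (z i)) \<otimes>\<^bsub>W\<^esub> c i \<otimes>\<^bsub>W\<^esub> c j \<ominus>\<^bsub>W\<^esub> c j \<otimes>\<^bsub>W\<^esub> (v (bracket x (z i)) \<otimes>\<^bsub>W\<^esub> c i))"
    unfolding nu_def using assms by (intro wg.A.commutator_finsum_left) auto
  also have "\<dots> = (\<Oplus>\<^bsub>W\<^esub>i\<in>J. \<ominus>\<^bsub>W\<^esub> (B (bracket x (z i)) (z' j) \<odot>\<^bsub>W\<^esub> c i))"
  proof (rule wg.A.finsum_cong')
    fix i assume i: "i \<in> J"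
    let ?a = "bracket x (z i)"
    have "c j \<otimes>\<^bsub>W\<^esub> (v ?a \<otimes>\<^bsub>W\<^esub> c i) = (c j \<otimes>\<^bsub>W\<^esub> v ?a) \<otimes>\<^bsub>W\<^esub> c i"
      using i assms by (simp add: wg.A.m_assoc)
    also have "\<dots> = v ?a \<otimes>\<^bsub>W\<^esub> (c j \<otimes>\<^bsub>W\<^esub> c i) \<oplus>\<^bsub>W\<^esub> B ?a (z' j) \<odot>\<^bsub>W\<^esub> c i"
      using i assms by (simp add: c_v wg.A.l_distr wg.A.m_assoc wg.A.smult_mult_left)
    also have "c j \<otimes>\<^bsub>W\<^esub> c i = c i \<otimes>\<^bsub>W\<^esub> c j"
      using i assms by (simp add: c_c)
    finally have *: "c j \<otimes>\<^bsub>W\<^esub> (v ?a \<otimes>\<^bsub>W\<^esub> c i) = v ?a \<otimes>\<^bsub>W\<^esub> c i \<otimes>\<^bsub>W\<^esub> c j \<oplus>\<^bsub>W\<^esub> B ?a (z' j) \<odot>\<^bsub>W\<^esub> c i"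
      using i assms by (simp add: wg.A.m_assoc)
    show "v ?a \<otimes>\<^bsub>W\<^esub> c i \<otimes>\<^bsub>W\<^esub> c j \<ominus>\<^bsub>W\<^esub> c j \<otimes>\<^bsub>W\<^esub> (v ?a \<otimes>\<^bsub>W\<^esub> c i) = \<ominus>\<^bsub>W\<^esub> (B ?a (z' j) \<odot>\<^bsub>W\<^esub> c i)"
      unfolding * using i assms by (simp add: wg.A.minus_eq_iff wg.A.a_ac wg.A.r_neg1 wg.A.r_neg2)
  qed (use assms in auto)
  also have "\<dots> = \<ominus>\<^bsub>W\<^esub> (\<Oplus>\<^bsub>W\<^esub>i\<in>J. B (bracket x (z i)) (z' j) \<odot>\<^bsub>W\<^esub> c i)"
    by (rule wg.A.finsum_a_inv) auto
  finally show ?thesis .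
qed

text \<open>For the bracket, \<open>\<nu> x\<close> acts as a derivation on each summand of
  \<open>\<nu> y\<close>. The vector factor turns into \<open>[x, [y, z\<^sub>j]]\<close>, the
  covector factors resum to the terms with \<open>[y, [x, z\<^sub>i]]\<close>, and the difference is
  governed by the Jacobi identity.\<close>

sublocale \<nu>: lie_hom_into scale bracket kk W \<nu>
proof
  fix x y assume xy: "x \<in> kk" "y \<in> kk"
  have [simp]: "bracket u (z i) \<in> pp" if "i \<in> J" "u \<in> kk" for u i using that by (simp add: bracket_kk_pp)
  show "\<nu> x \<in> carrier W" using xy by simp
  have "\<nu> (x + y) = (\<Oplus>\<^bsub>W\<^esub>i\<in>J. v (bracket x (z i)) \<otimes>\<^bsub>W\<^esub> c i \<oplus>\<^bsub>W\<^esub> v (bracket y (z i)) \<otimes>\<^bsub>W\<^esub> c i)"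
    unfolding nu_def using xy
    by (intro wg.A.finsum_cong' refl) (simp_all add: bracket_add_left v.add wg.A.l_distr)
  also have "\<dots> = \<nu> x \<oplus>\<^bsub>W\<^esub> \<nu> y"
    unfolding nu_def using xy by (intro wg.A.finsum_addf) auto
  finally show "\<nu> (x + y) = \<nu> x \<oplus>\<^bsub>W\<^esub> \<nu> y" .
  have "\<nu> (scale r x) = (\<Oplus>\<^bsub>W\<^esub>i\<in>J. r \<odot>\<^bsub>W\<^esub> (v (bracket x (z i)) \<otimes>\<^bsub>W\<^esub> c i))" for r
    unfolding nu_def using xy
    by (intro wg.A.finsum_cong' refl) (simp_all add: bracket_scale_left v.smult wg.A.smult_mult_left)
  then show "\<nu> (scale r x) = r \<odot>\<^bsub>W\<^esub> \<nu> x" for r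
    unfolding nu_def using xy by (subst wg.A.smult_finsum) auto
  have "\<nu> x \<otimes>\<^bsub>W\<^esub> \<nu> y \<ominus>\<^bsub>W\<^esub> \<nu> y \<otimes>\<^bsub>W\<^esub> \<nu> x =
    (\<Oplus>\<^bsub>W\<^esub>j\<in>J. \<nu> x \<otimes>\<^bsub>W\<^esub> (v (bracket y (z j)) \<otimes>\<^bsub>W\<^esub> c j) \<ominus>\<^bsub>W\<^esub> v (bracket y (z j)) \<otimes>\<^bsub>W\<^esub> c j \<otimes>\<^bsub>W\<^esub> \<nu> x)"
    unfolding nu_def[of _ _ _ _ _ _ y] using xy by (intro wg.A.commutator_finsum_right) auto
  also have "\<dots> = (\<Oplus>\<^bsub>W\<^esub>j\<in>J. v (bracket x (bracket y (z j))) \<otimes>\<^bsub>W\<^esub> c j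
     \<ominus>\<^bsub>W\<^esub> (\<Oplus>\<^bsub>W\<^esub>i\<in>J. B (bracket x (z i)) (z' j) \<odot>\<^bsub>W\<^esub> (v (bracket y (z j)) \<otimes>\<^bsub>W\<^esub> c i)))"
  proof (rule wg.A.finsum_cong')
    fix j assume j: "j \<in> J"
    have S: "(\<Oplus>\<^bsub>W\<^esub>i\<in>J. B (bracket x (z i)) (z' j) \<odot>\<^bsub>W\<^esub> c i) \<in> carrier W"
      by (intro wg.A.finsum_closed) auto
    have "\<nu> x \<otimes>\<^bsub>W\<^esub> (v (bracket y (z j)) \<otimes>\<^bsub>W\<^esub> c j) \<ominus>\<^bsub>W\<^esub> v (bracket y (z j)) \<otimes>\<^bsub>W\<^esub> c j \<otimes>\<^bsub>W\<^esub> \<nu> x =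
      v (bracket x (bracket y (z j))) \<otimes>\<^bsub>W\<^esub> c j \<ominus>\<^bsub>W\<^esub> v (bracket y (z j)) \<otimes>\<^bsub>W\<^esub> (\<Oplus>\<^bsub>W\<^esub>i\<in>J. B (bracket x (z i)) (z' j) \<odot>\<^bsub>W\<^esub> c i)"
      using xy j S
      by (subst wg.A.commutator_mult) (simp_all add: \<nu>_v \<nu>_c wg.A.r_minus, simp add: wg.A.minus_eq)
    also have "v (bracket y (z j)) \<otimes>\<^bsub>W\<^esub> (\<Oplus>\<^bsub>W\<^esub>i\<in>J. B (bracket x (z i)) (z' j) \<odot>\<^bsub>W\<^esub> c i) =
       (\<Oplus>\<^bsub>W\<^esub>i\<in>J. B (bracket x (z i)) (z' j) \<odot>\<^bsub>W\<^esub> (v (bracket y (z j)) \<otimes>\<^bsub>W\<^esub> c i))"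
      using xy j by (intro wg.A.mult_finsum_smult) auto
    finally show "\<nu> x \<otimes>\<^bsub>W\<^esub> (v (bracket y (z j)) \<otimes>\<^bsub>W\<^esub> c j) \<ominus>\<^bsub>W\<^esub> v (bracket y (z j)) \<otimes>\<^bsub>W\<^esub> c j \<otimes>\<^bsub>W\<^esub> \<nu> x =
      v (bracket x (bracket y (z j))) \<otimes>\<^bsub>W\<^esub> c j
     \<ominus>\<^bsub>W\<^esub> (\<Oplus>\<^bsub>W\<^esub>i\<in>J. B (bracket x (z i)) (z' j) \<odot>\<^bsub>W\<^esub> (v (bracket y (z j)) \<otimes>\<^bsub>W\<^esub> c i))" .
  qed (use xy in \<open>auto intro!: wg.A.minus_closed wg.A.finsum_closed simp: bracket_kk_pp\<close>)
  also have "\<dots> = (\<Oplus>\<^bsub>W\<^esub>j\<in>J. v (bracket x (bracket y (z j))) \<otimes>\<^bsub>W\<^esub> c j)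
     \<ominus>\<^bsub>W\<^esub> (\<Oplus>\<^bsub>W\<^esub>j\<in>J. \<Oplus>\<^bsub>W\<^esub>i\<in>J. B (bracket x (z i)) (z' j) \<odot>\<^bsub>W\<^esub> (v (bracket y (z j)) \<otimes>\<^bsub>W\<^esub> c i))"
    using xy by (intro wg.A.finsum_minus) (auto intro!: wg.A.finsum_closed simp: bracket_kk_pp)
  \<comment> \<open>With \<open>i\<close> outside, the coefficients are the coordinates of
    \<open>[x, z\<^sub>i]\<close> in the basis \<open>z\<close>, so the sum over \<open>j\<close>
    collapses to one bracket with \<open>y\<close>.\<close>
  also have "(\<Oplus>\<^bsub>W\<^esub>j\<in>J. \<Oplus>\<^bsub>W\<^esub>i\<in>J. B (bracket x (z i)) (z' j) \<odot>\<^bsub>W\<^esub> (v (bracket y (z j)) \<otimes>\<^bsub>W\<^esub> c i)) =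
    (\<Oplus>\<^bsub>W\<^esub>i\<in>J. \<Oplus>\<^bsub>W\<^esub>j\<in>J. B (bracket x (z i)) (z' j) \<odot>\<^bsub>W\<^esub> (v (bracket y (z j)) \<otimes>\<^bsub>W\<^esub> c i))"
    using xy by (intro wg.A.finsum_swap) auto
  also have "\<dots> = (\<Oplus>\<^bsub>W\<^esub>i\<in>J. v (bracket y (bracket x (z i))) \<otimes>\<^bsub>W\<^esub> c i)"
  proof (rule wg.A.finsum_cong')
    fix i assume i: "i \<in> J"
    have "(\<Oplus>\<^bsub>W\<^esub>j\<in>J. B (bracket x (z i)) (z' j) \<odot>\<^bsub>W\<^esub> (v (bracket y (z j)) \<otimes>\<^bsub>W\<^esub> c i)) =
      (\<Oplus>\<^bsub>W\<^esub>j\<in>J. B (bracket x (z i)) (z' j) \<odot>\<^bsub>W\<^esub> v (bracket y (z j))) \<otimes>\<^bsub>W\<^esub> c i"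
      using xy i by (intro wg.A.mult_finsum_smult[symmetric]) auto
    also have "(\<Oplus>\<^bsub>W\<^esub>j\<in>J. B (bracket x (z i)) (z' j) \<odot>\<^bsub>W\<^esub> v (bracket y (z j))) =
      v (\<Sum>j\<in>J. scale (B (bracket x (z i)) (z' j)) (bracket y (z j)))"
      using xy by (intro linear_into_sum[OF v.linear_into_axioms subspace_pp, symmetric]) simp
    also have "\<dots> = v (bracket y (bracket x (z i)))"
      using xy i by (simp add: z_expand flip: bracket_sum_right)
    finally show "(\<Oplus>\<^bsub>W\<^esub>j\<in>J. B (bracket x (z i)) (z' j) \<odot>\<^bsub>W\<^esub> (v (bracket y (z j)) \<otimes>\<^bsub>W\<^esub> c i)) =
      v (bracket y (bracket x (z i))) \<otimes>\<^bsub>W\<^esub> c i" .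
  qed (use xy in \<open>auto simp: bracket_kk_pp\<close>)
  also have "(\<Oplus>\<^bsub>W\<^esub>j\<in>J. v (bracket x (bracket y (z j))) \<otimes>\<^bsub>W\<^esub> c j) \<ominus>\<^bsub>W\<^esub> \<dots> =
    (\<Oplus>\<^bsub>W\<^esub>j\<in>J. v (bracket x (bracket y (z j))) \<otimes>\<^bsub>W\<^esub> c j \<ominus>\<^bsub>W\<^esub> v (bracket y (bracket x (z j))) \<otimes>\<^bsub>W\<^esub> c j)"
    using xy by (intro wg.A.finsum_minus[symmetric]) (auto simp: bracket_kk_pp)
  also have "\<dots> = \<nu> (bracket x y)"
    unfolding nu_def
  proof (rule wg.A.finsum_cong')
    fix j assume j: "j \<in> J"
    let ?a = "bracket x (bracket y (z j))" and ?b = "bracket y (bracket x (z j))"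
    have ab: "?a \<in> pp" "?b \<in> pp" "- ?b \<in> pp"
      using xy j by (simp_all add: bracket_kk_pp subspace_neg subspace_pp)
    have "bracket (bracket x y) (z j) = ?a + (- ?b)" by (simp add: bracket_bracket)
    then have "v (bracket (bracket x y) (z j)) = v ?a \<ominus>\<^bsub>W\<^esub> v ?b"
      using ab by (simp only: v.add linear_into_uminus[OF v.linear_into_axioms] wg.A.minus_eq)
    then show "v ?a \<otimes>\<^bsub>W\<^esub> c j \<ominus>\<^bsub>W\<^esub> v ?b \<otimes>\<^bsub>W\<^esub> c j = v (bracket (bracket x y) (z j)) \<otimes>\<^bsub>W\<^esub> c j"
      using ab j by (simp add: wg.A.minus_eq wg.A.l_distr wg.A.l_minus)
  qed (use xy in \<open>auto simp: bracket_kk_kk\<close>)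
  finally show "\<nu> (bracket x y) = \<nu> x \<otimes>\<^bsub>W\<^esub> \<nu> y \<ominus>\<^bsub>W\<^esub> \<nu> y \<otimes>\<^bsub>W\<^esub> \<nu> x" by (rule sym)
qed

sublocale t: tensor_pair g.U W
  by unfold_locales

text \<open>\<open>Delta\<close> takes its values over U(k), the Dirac elements live over U(g); both
  tensor products are needed until \<open>inclW\<close> relates them.\<close>

sublocale tk: tensor_pair k.U W
  by unfold_locales

section \<open>The commutator of the two Dirac elements\<close>

abbreviation "cross_term \<equiv> (\<Oplus>\<^bsub>t.T\<^esub>k\<in>I. t.t (g.ugen (w k)) (\<nu> (w' k)))"
abbreviation "casimir_pp \<equiv> (\<Oplus>\<^bsub>g.U\<^esub>i\<in>J. g.ugen (z' i) \<otimes>\<^bsub>g.U\<^esub> g.ugen (z i))"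
abbreviation "casimir_kk \<equiv> (\<Oplus>\<^bsub>g.U\<^esub>k\<in>I. g.ugen (w k) \<otimes>\<^bsub>g.U\<^esub> g.ugen (w' k))"

lemma linear_t_left: "b \<in> carrier W \<Longrightarrow> linear_into scale kk t.T (\<lambda>x. t.t (g.ugen x) b)"
  by (intro linear_into.intro linear_into_axioms.intro k.closed_subset_axioms t.T.assoc_algebra_axioms)
    (simp_all add: g.U.add g.U.smult t.t_add_left t.t_smult_left)

lemma linear_t_right: "linear_into scale V W f \<Longrightarrow> linear_into scale V t.T (\<lambda>y. t.t (g.ugen x) (f y))"
proof -
  assume "linear_into scale V W f"
  then interpret f: linear_into scale V W f .
  show ?thesis
    by (intro linear_into.intro linear_into_axioms.intro f.closed_subset_axioms t.T.assoc_algebra_axioms)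
      (simp_all add: f.add f.smult t.t_add_right t.t_smult_right)
qed

lemma linear_v_mult: "b \<in> carrier W \<Longrightarrow> linear_into scale pp W (\<lambda>y. v y \<otimes>\<^bsub>W\<^esub> b)"
  by (intro linear_into.intro linear_into_axioms.intro p.closed_subset_axioms wg.A.assoc_algebra_axioms)
    (simp_all add: v.add v.smult wg.A.l_distr wg.A.smult_mult_left)

text \<open>Source of the minus sign in front of \<open>cross_term\<close>: transposition produces
  brackets with \<open>z j\<close> on the left, whereas \<open>\<nu>\<close> has it on the
  right.\<close>

lemma v_c_sum:
  assumes "x \<in> kk"
  shows "(\<Oplus>\<^bsub>W\<^esub>j\<in>J. v (bracket (z j) x) \<otimes>\<^bsub>W\<^esub> c j) = \<ominus>\<^bsub>W\<^esub> \<nu> x"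
proof -
  have "(\<Oplus>\<^bsub>W\<^esub>j\<in>J. v (bracket (z j) x) \<otimes>\<^bsub>W\<^esub> c j) = (\<Oplus>\<^bsub>W\<^esub>j\<in>J. \<ominus>\<^bsub>W\<^esub> (v (bracket x (z j)) \<otimes>\<^bsub>W\<^esub> c j))"
  proof (intro wg.A.finsum_cong' refl)
    fix j assume j: "j \<in> J"
    have "v (bracket (z j) x) = \<ominus>\<^bsub>W\<^esub> v (bracket x (z j))"
      using j assms bracket_skew[of "z j" x] linear_into_uminus[OF v.linear_into_axioms]
      by (simp add: bracket_kk_pp)
    then show "v (bracket (z j) x) \<otimes>\<^bsub>W\<^esub> c j = \<ominus>\<^bsub>W\<^esub> (v (bracket x (z j)) \<otimes>\<^bsub>W\<^esub> c j)"
      using j assms by (simp add: wg.A.l_minus bracket_kk_pp)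
  qed (use assms in \<open>auto simp: bracket_kk_pp\<close>)
  also have "\<dots> = \<ominus>\<^bsub>W\<^esub> \<nu> x"
    unfolding nu_def using assms by (intro wg.A.finsum_a_inv) (auto simp: bracket_kk_pp)
  finally show ?thesis .
qed

lemma sum_bracket_pp:
  "(\<Oplus>\<^bsub>t.T\<^esub>i\<in>J. \<Oplus>\<^bsub>t.T\<^esub>j\<in>J. t.t (g.ugen (bracket (z i) (z j))) (v (z' i) \<otimes>\<^bsub>W\<^esub> c j)) = \<ominus>\<^bsub>t.T\<^esub> cross_term"
proof -
  have "(\<Oplus>\<^bsub>t.T\<^esub>i\<in>J. \<Oplus>\<^bsub>t.T\<^esub>j\<in>J. t.t (g.ugen (bracket (z i) (z j))) (v (z' i) \<otimes>\<^bsub>W\<^esub> c j))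
      = (\<Oplus>\<^bsub>t.T\<^esub>j\<in>J. \<Oplus>\<^bsub>t.T\<^esub>i\<in>J. t.t (g.ugen (bracket (z i) (z j))) (v (z' i) \<otimes>\<^bsub>W\<^esub> c j))"
    by (intro t.T.finsum_swap) simp_all
  also have "\<dots> = (\<Oplus>\<^bsub>t.T\<^esub>j\<in>J. \<Oplus>\<^bsub>t.T\<^esub>k\<in>I. t.t (g.ugen (w k)) (v (bracket (z j) (w' k)) \<otimes>\<^bsub>W\<^esub> c j))"
  proof (intro t.T.finsum_cong' refl)
    fix j assume j: "j \<in> J"
    show "(\<Oplus>\<^bsub>t.T\<^esub>i\<in>J. t.t (g.ugen (bracket (z i) (z j))) (v (z' i) \<otimes>\<^bsub>W\<^esub> c j)) =
      (\<Oplus>\<^bsub>t.T\<^esub>k\<in>I. t.t (g.ugen (w k)) (v (bracket (z j) (w' k)) \<otimes>\<^bsub>W\<^esub> c j))"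
      \<comment> \<open>Invariance pairs right bracketing by \<open>z j\<close>, from p to k, with
        left bracketing by \<open>z j\<close>, from k to p, without a sign. The two pairs of dual
        bases are those of p and of k.\<close>
      by (rule dual_bases_adjoint[where F = "\<lambda>x y. t.t (g.ugen x) (v y \<otimes>\<^bsub>W\<^esub> c j)" and T = "\<lambda>x. bracket x (z j)"
          and T' = "bracket (z j)" and X = kk and Y = pp])
        (use j in \<open>simp_all add: t.T.assoc_algebra_axioms subspace_kk subspace_pp linear_t_left
          linear_t_right[OF linear_v_mult] bracket_pp_pp bracket_pp_kk B_invariant w_expand z'_expand\<close>)
  qed (auto intro!: t.T.finsum_closed simp: bracket_pp_kk)
  also have "\<dots> = (\<Oplus>\<^bsub>t.T\<^esub>k\<in>I. \<Oplus>\<^bsub>t.T\<^esub>j\<in>J. t.t (g.ugen (w k)) (v (bracket (z j) (w' k)) \<otimes>\<^bsub>W\<^esub> c j))"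
    by (intro t.T.finsum_swap) (simp_all add: bracket_pp_kk)
  also have "\<dots> = (\<Oplus>\<^bsub>t.T\<^esub>k\<in>I. \<ominus>\<^bsub>t.T\<^esub> t.t (g.ugen (w k)) (\<nu> (w' k)))"
  proof (intro t.T.finsum_cong' refl)
    fix k assume k: "k \<in> I"
    have "(\<Oplus>\<^bsub>t.T\<^esub>j\<in>J. t.t (g.ugen (w k)) (v (bracket (z j) (w' k)) \<otimes>\<^bsub>W\<^esub> c j)) =
      t.t (g.ugen (w k)) (\<ominus>\<^bsub>W\<^esub> \<nu> (w' k))"
      using k by (subst t.t_finsum_right[symmetric]) (auto simp: v_c_sum bracket_pp_kk)
    also have "\<dots> = \<ominus>\<^bsub>t.T\<^esub> t.t (g.ugen (w k)) (\<nu> (w' k))"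
      using k t.t_smult_right[of "g.ugen (w k)" "\<nu> (w' k)" "-1"]
      by (simp add: wg.A.smult_uminus t.T.smult_uminus)
    finally show "(\<Oplus>\<^bsub>t.T\<^esub>j\<in>J. t.t (g.ugen (w k)) (v (bracket (z j) (w' k)) \<otimes>\<^bsub>W\<^esub> c j)) =
      \<ominus>\<^bsub>t.T\<^esub> t.t (g.ugen (w k)) (\<nu> (w' k))" .
  qed auto
  also have "\<dots> = \<ominus>\<^bsub>t.T\<^esub> cross_term"
    by (intro t.T.finsum_a_inv) auto
  finally show ?thesis .
qed

text \<open>The numbers \<open>B (z' i) (z' j)\<close> are the coordinates of \<open>z' i\<close> in
  the basis \<open>z\<close>. Keeping them inside \<open>g.ugen\<close> lets the sum over
  \<open>j\<close> collapse the first factor to \<open>z' i\<close>.\<close>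

lemma sum_pp_pp:
  "(\<Oplus>\<^bsub>t.T\<^esub>i\<in>J. \<Oplus>\<^bsub>t.T\<^esub>j\<in>J.
      t.t (g.ugen (scale (B (z' i) (z' j)) (z j)) \<otimes>\<^bsub>g.U\<^esub> g.ugen (z i)) \<one>\<^bsub>W\<^esub>) = t.t casimir_pp \<one>\<^bsub>W\<^esub>"
proof -
  have "(\<Oplus>\<^bsub>t.T\<^esub>j\<in>J. t.t (g.ugen (scale (B (z' i) (z' j)) (z j)) \<otimes>\<^bsub>g.U\<^esub> g.ugen (z i)) \<one>\<^bsub>W\<^esub>)
      = t.t (g.ugen (z' i) \<otimes>\<^bsub>g.U\<^esub> g.ugen (z i)) \<one>\<^bsub>W\<^esub>" if i: "i \<in> J" for i
  proof -
    have "(\<Oplus>\<^bsub>t.T\<^esub>j\<in>J. t.t (g.ugen (scale (B (z' i) (z' j)) (z j)) \<otimes>\<^bsub>g.U\<^esub> g.ugen (z i)) \<one>\<^bsub>W\<^esub>)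
      = t.t ((\<Oplus>\<^bsub>g.U\<^esub>j\<in>J. g.ugen (scale (B (z' i) (z' j)) (z j))) \<otimes>\<^bsub>g.U\<^esub> g.ugen (z i)) \<one>\<^bsub>W\<^esub>"
      by (subst t.t_finsum_left[symmetric]) (auto simp: g.U.A.finsum_ldistr)
    also have "(\<Oplus>\<^bsub>g.U\<^esub>j\<in>J. g.ugen (scale (B (z' i) (z' j)) (z j))) = g.ugen (z' i)"
      using linear_into_sum[OF g.U.linear_into_axioms subspace_UNIV, of J z "\<lambda>j. B (z' i) (z' j)"] i
      by (simp add: z_expand g.U.smult)
    finally show ?thesis .
  qed
  then show ?thesis
    by (subst t.t_finsum_left) (auto intro!: t.T.finsum_cong'[OF refl])
qed

lemma commutator_dirac:
  "commutator t.T (\<Oplus>\<^bsub>t.T\<^esub>i\<in>J. t.t (g.ugen (z i)) (v (z' i))) (\<Oplus>\<^bsub>t.T\<^esub>j\<in>J. t.t (g.ugen (z j)) (c j))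
    = \<ominus>\<^bsub>t.T\<^esub> cross_term \<ominus>\<^bsub>t.T\<^esub> t.t casimir_pp \<one>\<^bsub>W\<^esub>"
proof -
  let ?p = "\<lambda>i. t.t (g.ugen (z i)) (v (z' i))" and ?m = "\<lambda>j. t.t (g.ugen (z j)) (c j)"
  let ?A = "\<lambda>i j. t.t (g.ugen (bracket (z i) (z j))) (v (z' i) \<otimes>\<^bsub>W\<^esub> c j)"
  let ?C = "\<lambda>i j. t.t (g.ugen (scale (B (z' i) (z' j)) (z j)) \<otimes>\<^bsub>g.U\<^esub> g.ugen (z i)) \<one>\<^bsub>W\<^esub>"
  \<comment> \<open>Both products are compared with the term \<open>?b\<close>, which has
    \<open>z j\<close> before \<open>z i\<close> in U(g) and the vector before the covector in W.
    The first product reaches it by a swap in U(g) and leaves \<open>?A\<close>, the second by a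
    swap in W and leaves \<open>?C\<close>; \<open>?b\<close> then cancels.\<close>
  have term_eq: "?p i \<otimes>\<^bsub>t.T\<^esub> ?m j \<ominus>\<^bsub>t.T\<^esub> ?m j \<otimes>\<^bsub>t.T\<^esub> ?p i = ?A i j \<ominus>\<^bsub>t.T\<^esub> ?C i j"
    if ij: "i \<in> J" "j \<in> J" for i j
  proof -
    let ?b = "t.t (g.ugen (z j) \<otimes>\<^bsub>g.U\<^esub> g.ugen (z i)) (v (z' i) \<otimes>\<^bsub>W\<^esub> c j)"
    have zz: "g.ugen (z i) \<otimes>\<^bsub>g.U\<^esub> g.ugen (z j) =
        g.ugen (bracket (z i) (z j)) \<oplus>\<^bsub>g.U\<^esub> g.ugen (z j) \<otimes>\<^bsub>g.U\<^esub> g.ugen (z i)"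
      using g.ugen_bracket[of "z i" "z j"] by (simp add: g.U.A.minus_eq_iff)
    have "?p i \<otimes>\<^bsub>t.T\<^esub> ?m j = ?A i j \<oplus>\<^bsub>t.T\<^esub> ?b"
      using ij by (simp add: t.t_mult zz t.t_add_left)
    moreover have "?m j \<otimes>\<^bsub>t.T\<^esub> ?p i = ?b \<oplus>\<^bsub>t.T\<^esub> ?C i j"
      using ij by (simp add: t.t_mult c_v t.t_add_right t.t_smult_right g.U.smult g.U.A.smult_mult_left t.t_smult_left)
    ultimately show ?thesis
      using ij by (simp add: t.T.add_minus_add_cancel)
  qed
  have p: "?p \<in> J \<rightarrow> carrier t.T" and m: "?m \<in> J \<rightarrow> carrier t.T" by auto
  have "commutator t.T (\<Oplus>\<^bsub>t.T\<^esub>i\<in>J. ?p i) (\<Oplus>\<^bsub>t.T\<^esub>j\<in>J. ?m j) =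
      (\<Oplus>\<^bsub>t.T\<^esub>i\<in>J. ?p i \<otimes>\<^bsub>t.T\<^esub> (\<Oplus>\<^bsub>t.T\<^esub>j\<in>J. ?m j) \<ominus>\<^bsub>t.T\<^esub> (\<Oplus>\<^bsub>t.T\<^esub>j\<in>J. ?m j) \<otimes>\<^bsub>t.T\<^esub> ?p i)"
    unfolding commutator_def using p m by (intro t.T.commutator_finsum_left t.T.finsum_closed) simp_all
  also have "\<dots> = (\<Oplus>\<^bsub>t.T\<^esub>i\<in>J. (\<Oplus>\<^bsub>t.T\<^esub>j\<in>J. ?A i j) \<ominus>\<^bsub>t.T\<^esub> (\<Oplus>\<^bsub>t.T\<^esub>j\<in>J. ?C i j))"
  proof (intro t.T.finsum_cong' refl)
    fix i assume i: "i \<in> J"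
    have "?p i \<otimes>\<^bsub>t.T\<^esub> (\<Oplus>\<^bsub>t.T\<^esub>j\<in>J. ?m j) \<ominus>\<^bsub>t.T\<^esub> (\<Oplus>\<^bsub>t.T\<^esub>j\<in>J. ?m j) \<otimes>\<^bsub>t.T\<^esub> ?p i =
        (\<Oplus>\<^bsub>t.T\<^esub>j\<in>J. ?p i \<otimes>\<^bsub>t.T\<^esub> ?m j \<ominus>\<^bsub>t.T\<^esub> ?m j \<otimes>\<^bsub>t.T\<^esub> ?p i)"
      using m i by (intro t.T.commutator_finsum_right) simp_all
    also have "\<dots> = (\<Oplus>\<^bsub>t.T\<^esub>j\<in>J. ?A i j \<ominus>\<^bsub>t.T\<^esub> ?C i j)"
      using i by (intro t.T.finsum_cong' refl term_eq) auto
    also have "\<dots> = (\<Oplus>\<^bsub>t.T\<^esub>j\<in>J. ?A i j) \<ominus>\<^bsub>t.T\<^esub> (\<Oplus>\<^bsub>t.T\<^esub>j\<in>J. ?C i j)"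
      using i by (intro t.T.finsum_minus) auto
    finally show "?p i \<otimes>\<^bsub>t.T\<^esub> (\<Oplus>\<^bsub>t.T\<^esub>j\<in>J. ?m j) \<ominus>\<^bsub>t.T\<^esub> (\<Oplus>\<^bsub>t.T\<^esub>j\<in>J. ?m j) \<otimes>\<^bsub>t.T\<^esub> ?p i =
      (\<Oplus>\<^bsub>t.T\<^esub>j\<in>J. ?A i j) \<ominus>\<^bsub>t.T\<^esub> (\<Oplus>\<^bsub>t.T\<^esub>j\<in>J. ?C i j)" .
  qed (auto intro!: t.T.minus_closed t.T.finsum_closed)
  also have "\<dots> = (\<Oplus>\<^bsub>t.T\<^esub>i\<in>J. \<Oplus>\<^bsub>t.T\<^esub>j\<in>J. ?A i j) \<ominus>\<^bsub>t.T\<^esub> (\<Oplus>\<^bsub>t.T\<^esub>i\<in>J. \<Oplus>\<^bsub>t.T\<^esub>j\<in>J. ?C i j)"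
    by (intro t.T.finsum_minus) (auto intro!: t.T.finsum_closed)
  finally show ?thesis by (simp only: sum_bracket_pp sum_pp_pp)
qed

section \<open>Images of the Casimir element of k\<close>

sublocale incl: lie_hom_into scale bracket kk g.U g.ugen
  by unfold_locales (simp_all add: g.U.add g.U.smult g.ugen_bracket)

text \<open>One computation that serves the inclusion into U(g), \<open>\<nu>\<close> and
  \<open>Delta\<close>.\<close>

lemma lift_casimir:
  assumes "lie_hom_into scale bracket kk A f"
  shows "env_lift A f (casimir_sub scale bracket kk I w w') = (\<Oplus>\<^bsub>A\<^esub>k\<in>I. f (w k) \<otimes>\<^bsub>A\<^esub> f (w' k))"
proof -
  interpret f: lie_hom_into scale bracket kk A f by fact
  have "env_lift A f (casimir_sub scale bracket kk I w w') =
      (\<Oplus>\<^bsub>A\<^esub>k\<in>I. env_lift A f (k.ugen (w k)) \<otimes>\<^bsub>A\<^esub> env_lift A f (k.ugen (w' k)))"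
    unfolding casimir_sub_def by (rule f.lift.hom_finsum_mult) auto
  also have "\<dots> = (\<Oplus>\<^bsub>A\<^esub>k\<in>I. f (w k) \<otimes>\<^bsub>A\<^esub> f (w' k))"
    by (intro f.A.finsum_cong' refl) (auto simp: f.env_lift_ugen)
  finally show ?thesis .
qed

lemmas incl_casimir = lift_casimir[OF incl.lie_hom_into_axioms]
lemmas nu_casimir = lift_casimir[OF \<nu>.lie_hom_into_axioms]

lemma kgen_lie_hom: "lie_hom_into scale bracket kk k.U k.ugen"
  by unfold_locales (simp add: k.ugen_bracket)

sublocale \<Delta>: lie_hom_into scale bracket kk tk.T "Delta scale bracket kk pp J z zs"
proof -
  have "Delta scale bracket kk pp J z zs =
      (\<lambda>x. tk.t (k.ugen x) \<one>\<^bsub>W\<^esub> \<oplus>\<^bsub>tk.T\<^esub> tk.t \<one>\<^bsub>k.U\<^esub> (\<nu> x))"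
    by (rule ext) (simp add: Delta_def env_weyl_tensor_def env_weyl_def)
  then show "lie_hom_into scale bracket kk tk.T (Delta scale bracket kk pp J z zs)"
    using lie_hom_into_tensor[OF kgen_lie_hom \<nu>.lie_hom_into_axioms] by simp
qed

sublocale inclW: tensor_hom_pair k.U W g.U W "env_lift g.U g.ugen" id
  by unfold_locales (auto intro: ring_hom_memI)

lemma cross_term_symmetric:
  "(\<Oplus>\<^bsub>t.T\<^esub>k\<in>I. t.t (g.ugen (w' k)) (\<nu> (w k))) = cross_term"
proof -
  have expand: "(\<Sum>k\<in>I. scale (B x (w k)) (w' k)) = x" if "x \<in> kk" for x
    using w'_expand[OF that] by (simp add: B_sym[of x])
  \<comment> \<open>The second pair of dual bases is \<open>w'\<close>, \<open>w\<close> with roles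
    exchanged, and the operator is the identity, written out as \<open>id\<close> so that the sum
    has the shape of \<open>dual_bases_adjoint\<close>.\<close>
  have "(\<Oplus>\<^bsub>t.T\<^esub>k\<in>I. t.t (g.ugen (id (w k))) (\<nu> (w' k))) =
      (\<Oplus>\<^bsub>t.T\<^esub>k\<in>I. t.t (g.ugen (w' k)) (\<nu> (id (w k))))"
    by (rule dual_bases_adjoint[where F = "\<lambda>x y. t.t (g.ugen x) (\<nu> y)" and T = id and T' = id
          and X = kk and Y = kk])
      (simp_all add: t.T.assoc_algebra_axioms subspace_kk linear_t_left
        linear_t_right[OF \<nu>.linear_into_axioms] expand w'_expand)
  then show ?thesis by simp
qed

lemma inclW_Delta:
  assumes "x \<in> kk"
  shows "alg_tensor_map g.U W (env_lift g.U g.ugen) id (Delta scale bracket kk pp J z zs x) =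
    t.t (g.ugen x) \<one>\<^bsub>W\<^esub> \<oplus>\<^bsub>t.T\<^esub> t.t \<one>\<^bsub>g.U\<^esub> (\<nu> x)"
proof -
  interpret h: assoc_algebra_hom tk.T t.T "alg_tensor_map g.U W (env_lift g.U g.ugen) id"
    by (rule inclW.alg_tensor_map_hom)
  show ?thesis
    using assms by (simp add: Delta_def env_weyl_tensor_def env_weyl_def h.hom_add inclW.alg_tensor_map_t
      incl.env_lift_ugen incl.lift.hom_one)
qed

lemma inclW_Delta_casimir:
  "alg_tensor_map g.U W (env_lift g.U g.ugen) id
     (env_lift tk.T (Delta scale bracket kk pp J z zs) (casimir_sub scale bracket kk I w w'))
   = t.t casimir_kk \<one>\<^bsub>W\<^esub> \<oplus>\<^bsub>t.T\<^esub> (cross_term \<oplus>\<^bsub>t.T\<^esub> cross_term)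
     \<oplus>\<^bsub>t.T\<^esub> t.t \<one>\<^bsub>g.U\<^esub> (\<Oplus>\<^bsub>W\<^esub>k\<in>I. \<nu> (w k) \<otimes>\<^bsub>W\<^esub> \<nu> (w' k))"
proof -
  let ?D = "Delta scale bracket kk pp J z zs"
  interpret h: assoc_algebra_hom tk.T t.T "alg_tensor_map g.U W (env_lift g.U g.ugen) id"
    by (rule inclW.alg_tensor_map_hom)
  have "env_lift tk.T ?D (casimir_sub scale bracket kk I w w') = (\<Oplus>\<^bsub>tk.T\<^esub>k\<in>I. ?D (w k) \<otimes>\<^bsub>tk.T\<^esub> ?D (w' k))"
    by (rule lift_casimir[OF \<Delta>.lie_hom_into_axioms])
  then have "alg_tensor_map g.U W (env_lift g.U g.ugen) id (env_lift tk.T ?D (casimir_sub scale bracket kk I w w'))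
    = (\<Oplus>\<^bsub>t.T\<^esub>k\<in>I. alg_tensor_map g.U W (env_lift g.U g.ugen) id (?D (w k) \<otimes>\<^bsub>tk.T\<^esub> ?D (w' k)))"
    by (simp add: h.hom_finsum Pi_def)
  \<comment> \<open>The factors are mapped to U(g) before they are multiplied out, so that the mixed
    terms land in the algebra of \<open>cross_term\<close>.\<close>
  also have "\<dots> = (\<Oplus>\<^bsub>t.T\<^esub>k\<in>I. t.t (g.ugen (w k) \<otimes>\<^bsub>g.U\<^esub> g.ugen (w' k)) \<one>\<^bsub>W\<^esub>
      \<oplus>\<^bsub>t.T\<^esub> (t.t (g.ugen (w k)) (\<nu> (w' k)) \<oplus>\<^bsub>t.T\<^esub> t.t (g.ugen (w' k)) (\<nu> (w k)))
      \<oplus>\<^bsub>t.T\<^esub> t.t \<one>\<^bsub>g.U\<^esub> (\<nu> (w k) \<otimes>\<^bsub>W\<^esub> \<nu> (w' k)))"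
    by (intro t.T.finsum_cong' refl)
      (auto simp: h.hom_mult inclW_Delta t.T.l_distr t.T.r_distr t.t_mult t.T.a_ac)
  also have "\<dots> = (\<Oplus>\<^bsub>t.T\<^esub>k\<in>I. t.t (g.ugen (w k) \<otimes>\<^bsub>g.U\<^esub> g.ugen (w' k)) \<one>\<^bsub>W\<^esub>)
      \<oplus>\<^bsub>t.T\<^esub> (cross_term \<oplus>\<^bsub>t.T\<^esub> (\<Oplus>\<^bsub>t.T\<^esub>k\<in>I. t.t (g.ugen (w' k)) (\<nu> (w k))))
      \<oplus>\<^bsub>t.T\<^esub> (\<Oplus>\<^bsub>t.T\<^esub>k\<in>I. t.t \<one>\<^bsub>g.U\<^esub> (\<nu> (w k) \<otimes>\<^bsub>W\<^esub> \<nu> (w' k)))"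
    by (simp add: t.T.finsum_addf Pi_def)
  also have "(\<Oplus>\<^bsub>t.T\<^esub>k\<in>I. t.t (g.ugen (w k) \<otimes>\<^bsub>g.U\<^esub> g.ugen (w' k)) \<one>\<^bsub>W\<^esub>) = t.t casimir_kk \<one>\<^bsub>W\<^esub>"
    by (rule t.t_finsum_left[symmetric]) auto
  also have "(\<Oplus>\<^bsub>t.T\<^esub>k\<in>I. t.t \<one>\<^bsub>g.U\<^esub> (\<nu> (w k) \<otimes>\<^bsub>W\<^esub> \<nu> (w' k))) = t.t \<one>\<^bsub>g.U\<^esub> (\<Oplus>\<^bsub>W\<^esub>k\<in>I. \<nu> (w k) \<otimes>\<^bsub>W\<^esub> \<nu> (w' k))"
    by (rule t.t_finsum_right[symmetric]) auto
  finally show ?thesis by (simp only: cross_term_symmetric)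
qed

end

theorem theorem3p3:
  fixes scale :: "'k::field_char_0 \<Rightarrow> 'g::ab_group_add \<Rightarrow> 'g"
    and bracket :: "'g \<Rightarrow> 'g \<Rightarrow> 'g"
    and B :: "'g \<Rightarrow> 'g \<Rightarrow> 'k"
    and kk pp :: "'g set"
    and I :: "'i set" and w w' :: "'i \<Rightarrow> 'g"
    and J :: "'j set" and z z' :: "'j \<Rightarrow> 'g" and zs :: "'j \<Rightarrow> 'g \<Rightarrow> 'k"
  assumes "z2_graded_quadratic_lie_algebra scale bracket B kk pp"
    and "is_basis scale kk I w" and "dual_family B kk I w w'"
    and "is_basis scale pp J z" and "dual_family B pp J z z'"
    and "dual_basis scale pp J z zs"
  defines "Ug \<equiv> env_algebra scale bracket UNIV"
    and "W \<equiv> double_weyl scale pp"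
    and "UW \<equiv> env_weyl scale bracket UNIV pp"
    and "tens \<equiv> env_weyl_tensor scale bracket UNIV pp"
    and "Dplus \<equiv> dirac_plus scale bracket pp J z z'"
    and "Dminus \<equiv> dirac_minus scale bracket pp J z zs"
    and "\<Omega>k \<equiv> casimir_sub scale bracket kk I w w'"
    and "\<Omega>g \<equiv> casimir scale bracket kk I w w' J z z'"
    and "incl \<equiv> env_incl scale bracket"
    and "inclW \<equiv> env_weyl_incl scale bracket pp"
    and "\<nu> \<equiv> nu scale bracket pp J z zs"
    and "\<nu>U \<equiv> nu_ext scale bracket pp J z zs"
    and "\<Delta>U \<equiv> Delta_ext scale bracket kk pp J z zs"
  shows "commutator UW Dplus Dminus =
           tens (\<ominus>\<^bsub>Ug\<^esub> \<Omega>g \<oplus>\<^bsub>Ug\<^esub> incl \<Omega>k) \<one>\<^bsub>W\<^esub>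
             \<ominus>\<^bsub>UW\<^esub> (\<Oplus>\<^bsub>UW\<^esub>i\<in>I. tens (env_gen scale bracket UNIV (w i)) (\<nu> (w' i)))
       \<and> commutator UW Dplus Dminus =
           tens (\<ominus>\<^bsub>Ug\<^esub> \<Omega>g \<oplus>\<^bsub>Ug\<^esub> ((3/2) \<odot>\<^bsub>Ug\<^esub> incl \<Omega>k)) \<one>\<^bsub>W\<^esub>
             \<ominus>\<^bsub>UW\<^esub> ((1/2) \<odot>\<^bsub>UW\<^esub> inclW (\<Delta>U \<Omega>k))
             \<oplus>\<^bsub>UW\<^esub> ((1/2) \<odot>\<^bsub>UW\<^esub> tens \<one>\<^bsub>Ug\<^esub> (\<nu>U \<Omega>k))"
proof -
  interpret S: symplectic_dirac scale bracket B kk pp I w w' J z z' zs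
    using assms(1-6) by (simp add: symplectic_dirac_def symplectic_dirac_axioms_def)
  let ?T = "alg_tensor Ug W" and ?t = "pure_tensor Ug W"
  let ?N = "\<Oplus>\<^bsub>W\<^esub>k\<in>I. \<nu> (w k) \<otimes>\<^bsub>W\<^esub> \<nu> (w' k)"
  let ?X = "\<Oplus>\<^bsub>?T\<^esub>i\<in>I. ?t (env_gen scale bracket UNIV (w i)) (\<nu> (w' i))"
  let ?K = "\<Oplus>\<^bsub>Ug\<^esub>k\<in>I. env_gen scale bracket UNIV (w k) \<otimes>\<^bsub>Ug\<^esub> env_gen scale bracket UNIV (w' k)"
  let ?C = "\<Oplus>\<^bsub>Ug\<^esub>i\<in>J. env_gen scale bracket UNIV (z' i) \<otimes>\<^bsub>Ug\<^esub> env_gen scale bracket UNIV (z i)"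
  note defs = Ug_def W_def \<nu>_def
  have UW: "UW = ?T" "tens = ?t"
    by (simp_all add: UW_def tens_def env_weyl_def env_weyl_tensor_def defs)
  have comm: "commutator UW Dplus Dminus = \<ominus>\<^bsub>?T\<^esub> ?X \<ominus>\<^bsub>?T\<^esub> ?t ?C \<one>\<^bsub>W\<^esub>"
    using S.commutator_dirac
    by (simp only: UW Dplus_def Dminus_def dirac_plus_def dirac_minus_def env_weyl_def env_weyl_tensor_def defs)
  have incl_\<Omega>k: "incl \<Omega>k = ?K"
    using S.incl_casimir by (simp only: incl_def \<Omega>k_def env_incl_def defs)
  have \<Omega>g: "\<Omega>g = ?K \<oplus>\<^bsub>Ug\<^esub> ?C"
    using S.incl_casimir by (simp only: \<Omega>g_def casimir_def env_incl_def defs)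
  have \<nu>U: "\<nu>U \<Omega>k = ?N"
    using S.nu_casimir by (simp only: \<nu>U_def nu_ext_def \<Omega>k_def defs)
  have \<Delta>U: "inclW (\<Delta>U \<Omega>k) = ?t ?K \<one>\<^bsub>W\<^esub> \<oplus>\<^bsub>?T\<^esub> (?X \<oplus>\<^bsub>?T\<^esub> ?X) \<oplus>\<^bsub>?T\<^esub> ?t \<one>\<^bsub>Ug\<^esub> ?N"
    using S.inclW_Delta_casimir
    by (simp only: \<Delta>U_def Delta_ext_def \<Omega>k_def inclW_def env_weyl_incl_def env_weyl_def env_incl_def defs)
  interpret T: tensor_pair Ug W
    unfolding defs by unfold_locales
  have K: "?K \<in> carrier Ug" and C: "?C \<in> carrier Ug" and N: "?N \<in> carrier W" and X: "?X \<in> carrier ?T"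
    unfolding defs by (intro S.g.U.A.finsum_closed S.wg.A.finsum_closed S.t.T.finsum_closed; auto)+
  \<comment> \<open>The scalar stays free because both formulas use this: \<open>r = 1\<close> for
    the first and \<open>r = 3/2\<close> for the second.\<close>
  have t_ops: "?t (\<ominus>\<^bsub>Ug\<^esub> (?K \<oplus>\<^bsub>Ug\<^esub> ?C) \<oplus>\<^bsub>Ug\<^esub> r \<odot>\<^bsub>Ug\<^esub> ?K) \<one>\<^bsub>W\<^esub> =
      \<ominus>\<^bsub>?T\<^esub> (?t ?K \<one>\<^bsub>W\<^esub> \<oplus>\<^bsub>?T\<^esub> ?t ?C \<one>\<^bsub>W\<^esub>) \<oplus>\<^bsub>?T\<^esub> r \<odot>\<^bsub>?T\<^esub> ?t ?K \<one>\<^bsub>W\<^esub>" for r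
    using K C T.t_smult_left[of "?K \<oplus>\<^bsub>Ug\<^esub> ?C" "\<one>\<^bsub>W\<^esub>" "-1"]
    by (simp add: T.t_add_left T.t_smult_left T.A.smult_uminus T.T.smult_uminus)
  have "commutator UW Dplus Dminus = ?t (\<ominus>\<^bsub>Ug\<^esub> \<Omega>g \<oplus>\<^bsub>Ug\<^esub> incl \<Omega>k) \<one>\<^bsub>W\<^esub> \<ominus>\<^bsub>?T\<^esub> ?X"
    using t_ops[of 1] K C X T.T.dirac_rearrange_1[of "?t ?K \<one>\<^bsub>W\<^esub>" "?t ?C \<one>\<^bsub>W\<^esub>" ?X]
    by (simp add: comm incl_\<Omega>k \<Omega>g)
  moreover have "commutator UW Dplus Dminus =
      ?t (\<ominus>\<^bsub>Ug\<^esub> \<Omega>g \<oplus>\<^bsub>Ug\<^esub> ((3/2) \<odot>\<^bsub>Ug\<^esub> incl \<Omega>k)) \<one>\<^bsub>W\<^esub>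
        \<ominus>\<^bsub>?T\<^esub> ((1/2) \<odot>\<^bsub>?T\<^esub> inclW (\<Delta>U \<Omega>k)) \<oplus>\<^bsub>?T\<^esub> ((1/2) \<odot>\<^bsub>?T\<^esub> ?t \<one>\<^bsub>Ug\<^esub> (\<nu>U \<Omega>k))"
    unfolding comm incl_\<Omega>k \<Omega>g \<nu>U \<Delta>U t_ops
    by (rule T.T.dirac_rearrange_half[symmetric]) (use K C N X in simp_all)
  ultimately show ?thesis unfolding UW by blast
qed

end
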